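(* Problem (MCSDIPT$_\infty$) can be solved by Algorithm A (both described in the context) in $O(n\log n)$ time.
   Context: Let $T=(V,E)$ be a tree rooted at $s$ with node set $V=\{s,v_1,\dots,v_n\}$ and edge set $E=\{e_1,\dots,e_n\}$, and let $Y=\{t_1,\dots,t_r\}$ be its set of leaf nodes. Each edge $e$ has an original weight $w(e)$, an upper bound $u(e)$ and a unit modification cost $c(e)$, with $u(e)\ge w(e)\ge 0$ and $c(e)>0$. For $t_k\in Y$, $P_k$ is the path from $s$ to $t_k$. For $e\in E$, $L(e)=\{t_k\in Y: e\in P_k\}$. For an edge weight vector $x$, put $x(P_k)=\sum_{e\in P_k}x(e)$ and $x(T)=\sum_{t_k\in Y}x(P_k)$ (the sum of root-leaf distances). Given a value $D$, problem (MCSDIPT$_\infty$) is: minimize $C(\bar w)=\max_{e\in E}c(e)(\bar w(e)-w(e))$ over $\bar w$ subject to $\bar w(T)\ge D$ and $w(e)\le\bar w(e)\le u(e)$ for all $e\in E$. Algorithm A (input $T,n,w,u,c,D$; output $\bar w$ and $C(\bar w)$): 1. For each $e\in E$ determine $L(e)$ and $F(e):=c(e)(u(e)-w(e))$; compute $u(T)$ and $\Delta D:=D-w(T)$. 2. If $u(T)<D$, return "The problem is infeasible" with $\bar w=[\,]$, $C(\bar w)=+\infty$. Otherwise, if $w(T)>D$, return $[w,0]$. 3. Otherwise sort the edges so that $F(e_{m_1})\le F(e_{m_2})\le\dots\le F(e_{m_n})$, and define $f(k)=\sum_{e\in E}|L(e)|\min\{u(e)-w(e),\,F(e_{m_k})/c(e)\}$.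 4. Initialize $a:=1$, $b:=n$, $k^*:=0$. While $b-a>1$ and $k^*=0$: put $k:=\lfloor (a+b)/2\rfloor$ and calculate $f(k)$, $f(k+1)$; if $f(k)\le\Delta D\le f(k+1)$ put $k^*:=k$; else if $f(k+1)<\Delta D$ put $a:=k$; else put $b:=k$. 5. With $E_\le:=\{e\in E: F(e)\le F(e_{m_{k^*}})\}$ and $\sigma:=\sum_{j=k^*+1}^n |L(e_{m_j})|/c(e_{m_j})$, put $\bar w(e):=u(e)$ for $e\in E_\le$ and $\bar w(e):=w(e)+\frac{F(e_{m_{k^*}})}{c(e)}+\frac{\Delta D-f(k^* )}{c(e)\,\sigma}$ for $e\in E\setminus E_\le$; put $C(\bar w):=F(e_{m_{k^*}})+\frac{\Delta D-f(k^* )}{\sigma}$. 6. Return $[\bar w,C(\bar w)]$.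
   Formalization: As printed (a:=1) Algorithm A fails when only k=1 fits; proved with a:=0 for all instances, and for a:=1 exactly off those exceptions. F(e_{m_0}):=0 is set for k*=0, and Step 1 computes |L(e)| instead of the sets L(e). *)

theory Defs
  imports
    Complex_Main
    "HOL-Library.Extended_Real"
    "HOL-Library.Landau_Symbols"
    "HOL-Library.Monad_Syntax"
    "Graph_Theory.Arc_Walk"
begin

section \<open>The optimization problem\<close>

text \<open>
  A rooted tree is a finite digraph, with every arc directed away from the root, in which
  every node is reached from the root by exactly one walk. (The constant \<open>tree\<close> of
  \<open>Graph_Theory\<close> is not usable here: it excludes directed cycles only, so it admits digraphs
  whose underlying undirected graph has cycles.)
\<close>

definition rooted_tree :: "('a, 'b) pre_digraph \<Rightarrow> 'a \<Rightarrow> bool" where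
  "rooted_tree T s \<longleftrightarrow>
     fin_digraph T \<and> s \<in> verts T \<and> (\<forall>v\<in>verts T. \<exists>!p. pre_digraph.awalk T s p v)"

definition leaf_nodes :: "('a, 'b) pre_digraph \<Rightarrow> 'a set" where
  "leaf_nodes T = {v \<in> verts T. out_arcs T v = {}}"

definition root_path :: "('a, 'b) pre_digraph \<Rightarrow> 'a \<Rightarrow> 'a \<Rightarrow> 'b set" where
  "root_path T s t = set (THE p. pre_digraph.awalk T s p t)"

definition leaves_through :: "('a, 'b) pre_digraph \<Rightarrow> 'a \<Rightarrow> 'b \<Rightarrow> 'a set" where
  "leaves_through T s e = {t \<in> leaf_nodes T. e \<in> root_path T s t}"

definition srd :: "('a, 'b) pre_digraph \<Rightarrow> 'a \<Rightarrow> ('b \<Rightarrow> real) \<Rightarrow> real" where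
  "srd T s x = (\<Sum>t\<in>leaf_nodes T. \<Sum>e\<in>root_path T s t. x e)"

definition feasible ::
  "('a, 'b) pre_digraph \<Rightarrow> 'a \<Rightarrow> ('b \<Rightarrow> real) \<Rightarrow> ('b \<Rightarrow> real) \<Rightarrow> real \<Rightarrow> ('b \<Rightarrow> real) \<Rightarrow> bool" where
  "feasible T s w u D x \<longleftrightarrow> srd T s x \<ge> D \<and> (\<forall>e\<in>arcs T. w e \<le> x e \<and> x e \<le> u e)"

definition max_cost ::
  "('a, 'b) pre_digraph \<Rightarrow> ('b \<Rightarrow> real) \<Rightarrow> ('b \<Rightarrow> real) \<Rightarrow> ('b \<Rightarrow> real) \<Rightarrow> real" where
  "max_cost T w c x = Max ((\<lambda>e. c e * (x e - w e)) ` arcs T)"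

definition optimal ::
  "('a, 'b) pre_digraph \<Rightarrow> 'a \<Rightarrow> ('b \<Rightarrow> real) \<Rightarrow> ('b \<Rightarrow> real) \<Rightarrow> ('b \<Rightarrow> real) \<Rightarrow> real \<Rightarrow> ('b \<Rightarrow> real) \<Rightarrow> bool" where
  "optimal T s w u c D x \<longleftrightarrow> feasible T s w u D x \<and>
     (\<forall>y. feasible T s w u D y \<longrightarrow> max_cost T w c x \<le> max_cost T w c y)"

text \<open>
  Input encoding: the nodes \<open>s, v\<^sub>1, \<dots>, v\<^sub>n\<close> are \<open>0, 1, \<dots>, n\<close> and the \<open>i\<close>-th edge is the
  pair \<open>es ! (i - 1)\<close> of parent and child.
\<close>

definition tree_of :: "(nat \<times> nat) list \<Rightarrow> (nat, nat \<times> nat) pre_digraph" where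
  "tree_of es = \<lparr>verts = {0..length es}, arcs = set es, tail = fst, head = snd\<rparr>"

definition mcsdipt_instance ::
  "(nat \<times> nat) list \<Rightarrow> (nat \<times> nat \<Rightarrow> real) \<Rightarrow> (nat \<times> nat \<Rightarrow> real) \<Rightarrow> (nat \<times> nat \<Rightarrow> real) \<Rightarrow> bool" where
  "mcsdipt_instance es w u c \<longleftrightarrow>
     es \<noteq> [] \<and> distinct es \<and> rooted_tree (tree_of es) 0 \<and>
     (\<forall>e\<in>set es. 0 \<le> w e \<and> w e \<le> u e \<and> 0 < c e)"

text \<open>
  \<open>([], \<infinity>)\<close> is the output for infeasible instances.
\<close>

definition solves ::
  "(nat \<times> nat) list \<Rightarrow> (nat \<times> nat \<Rightarrow> real) \<Rightarrow> (nat \<times> nat \<Rightarrow> real) \<Rightarrow> (nat \<times> nat \<Rightarrow> real) \<Rightarrow> real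
   \<Rightarrow> real list \<times> ereal \<Rightarrow> bool" where
  "solves es w u c D out \<longleftrightarrow>
     (if \<exists>y. feasible (tree_of es) 0 w u D y
      then \<exists>x. optimal (tree_of es) 0 w u c D x \<and>
               out = (map x es, ereal (max_cost (tree_of es) w c x))
      else out = ([], \<infinity>))"


section \<open>Cost model\<close>

text \<open>
  A computation is a value together with the number of elementary steps spent on it. One step
  (\<open>op\<close>) is an arithmetic operation or comparison on reals or indices, a Boolean connective,
  an access to a list constructor, or an array access; so this is the unit-cost real RAM.
  Lists that are used through \<open>rd\<close> and \<open>wr\<close> stand for arrays; no array is read
  again after it has been overwritten.
\<close>

datatype 'a tm = TM (val: 'a) (time: nat)

definition ops :: "nat \<Rightarrow> 'a \<Rightarrow> 'a tm" where
  "ops k x = TM x k"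

abbreviation op :: "'a \<Rightarrow> 'a tm" where
  "op x \<equiv> ops 1 x"

abbreviation ret :: "'a \<Rightarrow> 'a tm" where
  "ret x \<equiv> ops 0 x"

definition bind_tm :: "'a tm \<Rightarrow> ('a \<Rightarrow> 'b tm) \<Rightarrow> 'b tm" where
  "bind_tm m g = (case m of TM x s \<Rightarrow> case g x of TM y t \<Rightarrow> TM y (s + t))"

adhoc_overloading Monad_Syntax.bind \<rightleftharpoons> bind_tm

lemma bind_tm_cong [fundef_cong]:
  assumes "m = m'" and "\<And>x. x = val m' \<Longrightarrow> g x = g' x"
  shows "bind_tm m g = bind_tm m' g'"
  using assms by (cases m') (simp add: bind_tm_def)

definition rd :: "'a list \<Rightarrow> nat \<Rightarrow> 'a tm" where
  "rd xs i = op (xs ! i)"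

definition wr :: "'a list \<Rightarrow> nat \<Rightarrow> 'a \<Rightarrow> 'a list tm" where
  "wr xs i x = op (xs[i := x])"

definition new :: "nat \<Rightarrow> 'a \<Rightarrow> 'a list tm" where
  "new n x = ops (Suc n) (replicate n x)"

text \<open>Loops; one step per iteration pays for the loop control.\<close>

primrec for_each :: "'a list \<Rightarrow> ('a \<Rightarrow> 's \<Rightarrow> 's tm) \<Rightarrow> 's \<Rightarrow> 's tm" where
  "for_each [] g s = op s"
| "for_each (x # xs) g s = do { s' \<leftarrow> g x s; s'' \<leftarrow> op s'; for_each xs g s'' }"

definition tabulate :: "nat \<Rightarrow> (nat \<Rightarrow> real tm) \<Rightarrow> real list tm" where
  "tabulate n g =
     do { xs \<leftarrow> new n 0; for_each [0..<n] (\<lambda>i xs. do { x \<leftarrow> g i; wr xs i x }) xs }"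

definition total :: "nat \<Rightarrow> (nat \<Rightarrow> real tm) \<Rightarrow> real tm" where
  "total n g = for_each [0..<n] (\<lambda>i s. do { x \<leftarrow> g i; op (s + x) }) 0"


section \<open>The algorithm\<close>

text \<open>
  The sets \<open>L(e)\<close> enter the algorithm only through their cardinalities, and listing all of
  them may take quadratically many steps; so only the numbers \<open>|L(e)|\<close> are computed.
  Edges are visited in preorder with an explicit stack; the visited edges are collected in
  reverse order and so every edge is preceded by the edges below it.
\<close>

definition child_edges :: "(nat \<times> nat) list \<Rightarrow> nat list list tm" where
  "child_edges es =
     do { ch \<leftarrow> new (Suc (length es)) [];
          for_each [0..<length es]
            (\<lambda>i ch. do { (p, v) \<leftarrow> rd es i; l \<leftarrow> rd ch p; l' \<leftarrow> op (i # l); wr ch p l' }) ch }"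

definition visit :: "(nat \<times> nat) list \<Rightarrow> nat list list \<Rightarrow> nat list \<times> nat list \<Rightarrow> (nat list \<times> nat list) tm" where
  "visit es ch = (\<lambda>(stack, visited).
     case stack of
       [] \<Rightarrow> op (stack, visited)
     | i # rest \<Rightarrow>
         do { (p, v) \<leftarrow> rd es i;
              l \<leftarrow> rd ch v;
              stack' \<leftarrow> for_each l (\<lambda>j st. op (j # st)) rest;
              visited' \<leftarrow> op (i # visited);
              ret (stack', visited') })"

definition bottom_up_edges :: "(nat \<times> nat) list \<Rightarrow> nat list list \<Rightarrow> nat list tm" where
  "bottom_up_edges es ch =
     do { l \<leftarrow> rd ch 0;
          (stack, visited) \<leftarrow> for_each [0..<length es] (\<lambda>_. visit es ch) (l, []);
          ret visited }"

definition leaf_counts :: "(nat \<times> nat) list \<Rightarrow> real list tm" where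
  "leaf_counts es =
     do { ch \<leftarrow> child_edges es;
          order \<leftarrow> bottom_up_edges es ch;
          below \<leftarrow> new (Suc (length es)) 0;
          L \<leftarrow> new (length es) 0;
          (below', L') \<leftarrow> for_each order
            (\<lambda>i (below, L). do {
               (p, v) \<leftarrow> rd es i;
               l \<leftarrow> rd ch v;
               b \<leftarrow> rd below v;
               k \<leftarrow> op (if l = [] then 1 else b);
               b' \<leftarrow> rd below p;
               s \<leftarrow> op (b' + k);
               below' \<leftarrow> wr below p s;
               L' \<leftarrow> wr L i k;
               ret (below', L') }) (below, L);
          ret L' }"

fun merge_by :: "real list \<Rightarrow> nat list \<Rightarrow> nat list \<Rightarrow> nat list tm" where
  "merge_by F [] ys = op ys"
| "merge_by F xs [] = op xs"
| "merge_by F (x # xs) (y # ys) =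
     do { kx \<leftarrow> rd F x;
          ky \<leftarrow> rd F y;
          le \<leftarrow> op (kx \<le> ky);
          if le then do { zs \<leftarrow> merge_by F xs (y # ys); op (x # zs) }
          else do { zs \<leftarrow> merge_by F (x # xs) ys; op (y # zs) } }"

text \<open>Measuring and halving a list takes linear time.\<close>

definition halve :: "'a list \<Rightarrow> ('a list \<times> 'a list) tm" where
  "halve xs = ops (3 * length xs) (take (length xs div 2) xs, drop (length xs div 2) xs)"

lemma length_halve [termination_simp]:
  "length (fst (val (halve xs))) = length xs div 2"
  "length (snd (val (halve xs))) = length xs - length xs div 2"
  by (auto simp: halve_def ops_def)

fun sort_by :: "real list \<Rightarrow> nat list \<Rightarrow> nat list tm" where
  "sort_by F [] = op []"
| "sort_by F [x] = op [x]"
| "sort_by F (x # y # zs) =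
     do { p \<leftarrow> halve (x # y # zs);
          ls \<leftarrow> sort_by F (fst p);
          rs \<leftarrow> sort_by F (snd p);
          merge_by F ls rs }"

text \<open>
  \<open>level F m k\<close> is \<open>F(e\<^bsub>m\<^sub>k\<^esub>)\<close>, where \<open>m\<close> lists the edges by increasing \<open>F\<close>. The initial value
  \<open>0\<close> of \<open>k\<^sup>*\<close> is a legitimate outcome of the search, so the convention \<open>F(e\<^bsub>m\<^sub>0\<^esub>) = 0\<close> is
  needed; it yields \<open>f(0) = 0\<close>.
\<close>

definition level :: "real list \<Rightarrow> nat list \<Rightarrow> nat \<Rightarrow> real tm" where
  "level F m k =
     do { z \<leftarrow> op (k = 0);
          if z then op 0 else do { j \<leftarrow> op (k - 1); e \<leftarrow> rd m j; rd F e } }"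

definition eval_f ::
  "real list \<Rightarrow> real list \<Rightarrow> real list \<Rightarrow> real list \<Rightarrow> real list \<Rightarrow> nat list \<Rightarrow> nat \<Rightarrow> real tm" where
  "eval_f L w u c F m k =
     do { h \<leftarrow> level F m k;
          total (length w) (\<lambda>e. do {
            l \<leftarrow> rd L e; we \<leftarrow> rd w e; ue \<leftarrow> rd u e; ce \<leftarrow> rd c e;
            d \<leftarrow> op (ue - we); q \<leftarrow> op (h / ce); r \<leftarrow> op (min d q); op (l * r) }) }"

function search :: "(nat \<Rightarrow> real tm) \<Rightarrow> real \<Rightarrow> nat \<Rightarrow> nat \<Rightarrow> nat \<Rightarrow> nat tm" where
  "search f \<Delta> a b kstar =
     do { d \<leftarrow> op (b - a);
          t1 \<leftarrow> op (d > 1);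
          t2 \<leftarrow> op (kstar = 0);
          t3 \<leftarrow> op (t1 \<and> t2);
          if t3 then
            do { s \<leftarrow> op (a + b);
                 k \<leftarrow> op (s div 2);
                 k' \<leftarrow> op (k + 1);
                 fk \<leftarrow> f k;
                 fk' \<leftarrow> f k';
                 t4 \<leftarrow> op (fk \<le> \<Delta>);
                 t5 \<leftarrow> op (\<Delta> \<le> fk');
                 t6 \<leftarrow> op (t4 \<and> t5);
                 t7 \<leftarrow> op (fk' < \<Delta>);
                 if t6 then search f \<Delta> a b k
                 else if t7 then search f \<Delta> k b kstar
                 else search f \<Delta> a k kstar }
          else ret kstar }"
  by pat_completeness auto
termination
  by (relation "measure (\<lambda>(f, \<Delta>, a, b, kstar). if kstar = 0 then Suc (b - a) else 0)")
     (auto simp: ops_def split: if_splits)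

text \<open>
  The parameter \<open>a0\<close> is the value to which the left end \<open>a\<close> of the binary search is
  initialized. With \<open>a0 = 1\<close> the index \<open>k = 1\<close> is never tested, because \<open>k > a \<ge> 1\<close> whenever
  the loop body is entered; with \<open>a0 = 0\<close> every index in \<open>{1..<n}\<close> can be tested.
\<close>

definition algorithm_A ::
  "nat \<Rightarrow> (nat \<times> nat) list \<Rightarrow> real list \<Rightarrow> real list \<Rightarrow> real list \<Rightarrow> real \<Rightarrow> (real list \<times> ereal) tm" where
  "algorithm_A a0 es w u c D =
     do { n \<leftarrow> ops (Suc (length es)) (length es);
          L \<leftarrow> leaf_counts es;
          F \<leftarrow> tabulate n (\<lambda>e. do {
                 we \<leftarrow> rd w e; ue \<leftarrow> rd u e; ce \<leftarrow> rd c e; d \<leftarrow> op (ue - we); op (ce * d) });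
          uT \<leftarrow> total n (\<lambda>e. do { l \<leftarrow> rd L e; ue \<leftarrow> rd u e; op (l * ue) });
          wT \<leftarrow> total n (\<lambda>e. do { l \<leftarrow> rd L e; we \<leftarrow> rd w e; op (l * we) });
          \<Delta> \<leftarrow> op (D - wT);
          infeas \<leftarrow> op (uT < D);
          triv \<leftarrow> op (wT > D);
          if infeas then ret ([], \<infinity>)
          else if triv then ret (w, 0)
          else do {
            ids \<leftarrow> ops (Suc n) [0..<n];
            sorted_ids \<leftarrow> sort_by F ids;
            m \<leftarrow> ops (Suc n) sorted_ids;
            kstar \<leftarrow> search (eval_f L w u c F m) \<Delta> a0 n 0;
            h \<leftarrow> level F m kstar;
            fk \<leftarrow> eval_f L w u c F m kstar;
            r \<leftarrow> op (n - kstar);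
            \<sigma> \<leftarrow> total r (\<lambda>i. do {
                   j \<leftarrow> op (kstar + i); e \<leftarrow> rd m j; l \<leftarrow> rd L e; ce \<leftarrow> rd c e; op (l / ce) });
            rest \<leftarrow> op (\<Delta> - fk);
            wbar \<leftarrow> tabulate n (\<lambda>e. do {
                   Fe \<leftarrow> rd F e;
                   full \<leftarrow> op (Fe \<le> h);
                   if full then rd u e
                   else do {
                     we \<leftarrow> rd w e; ce \<leftarrow> rd c e;
                     q \<leftarrow> op (h / ce); d \<leftarrow> op (ce * \<sigma>); q' \<leftarrow> op (rest / d);
                     x \<leftarrow> op (we + q); op (x + q') } });
            q \<leftarrow> op (rest / \<sigma>);
            C \<leftarrow> op (h + q);
            ret (wbar, ereal C) } }"


section \<open>The instances on which the index 1 is needed\<close>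

text \<open>
  \<open>capped_gain h\<close> is \<open>f\<close> at the level \<open>h\<close>, so that \<open>f(k)\<close> is its value at the \<open>k\<close>-th smallest
  \<open>F(e)\<close>. The predicate says that \<open>k = 1\<close> is the index that the search has to find: either
  \<open>f(1) < D - w(T) < f(2)\<close>, or \<open>n = 2\<close> and \<open>f(1) < D - w(T) \<le> f(2)\<close>, where \<open>f(2) = u(T) - w(T)\<close>.
\<close>

definition capped_gain ::
  "(nat \<times> nat) list \<Rightarrow> (nat \<times> nat \<Rightarrow> real) \<Rightarrow> (nat \<times> nat \<Rightarrow> real) \<Rightarrow> (nat \<times> nat \<Rightarrow> real) \<Rightarrow> real \<Rightarrow> real" where
  "capped_gain es w u c h =
     (\<Sum>e\<in>set es. real (card (leaves_through (tree_of es) 0 e)) * min (u e - w e) (h / c e))"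

definition needs_index_1 ::
  "(nat \<times> nat) list \<Rightarrow> (nat \<times> nat \<Rightarrow> real) \<Rightarrow> (nat \<times> nat \<Rightarrow> real) \<Rightarrow> (nat \<times> nat \<Rightarrow> real) \<Rightarrow> real \<Rightarrow> bool" where
  "needs_index_1 es w u c D \<longleftrightarrow>
     (let Fs = sort (map (\<lambda>e. c e * (u e - w e)) es);
          \<Delta> = D - srd (tree_of es) 0 w
      in length es \<ge> 2 \<and> D \<le> srd (tree_of es) 0 u \<and>
         capped_gain es w u c (Fs ! 0) < \<Delta> \<and>
         (\<Delta> < capped_gain es w u c (Fs ! 1) \<or> length es = 2))"

end

theory Submission
  imports Defs "HOL-Library.Multiset"
begin

text \<open>
  Let \<open>G(h)\<close> be the increase of the sum of the root-leaf distances when every edge \<open>e\<close> is raised as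
  far as the cost \<open>h\<close> and the bound \<open>u(e)\<close> permit. Among the solutions of cost at most \<open>h\<close> this
  raise has the largest sum, and \<open>G\<close> is strictly increasing up to \<open>max F\<close>; so, for
  \<open>\<Delta> = D - w(T) \<ge> 0\<close> and \<open>0 \<le> h \<le> max F\<close>, the raise is optimal if \<open>G(h) = \<Delta>\<close>. Between two consecutive values
  \<open>F(e\<^bsub>m\<^sub>k\<^esub>)\<close> and \<open>F(e\<^bsub>m\<^sub>k\<^sub>+\<^sub>1\<^esub>)\<close> the function \<open>G\<close> is affine with slope \<open>\<sigma>\<close>, so the last step of the
  algorithm computes \<open>h\<close> by interpolation, provided that the search has found \<open>k\<close> with
  \<open>f(k) \<le> \<Delta> \<le> f(k + 1)\<close>, where \<open>f(0) = 0\<close>. The search halves an interval whose ends satisfy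
  \<open>f(a + 1) < \<Delta>\<close> and \<open>\<Delta> < f(b)\<close> unless they are the initial ones.

  For the running time: the traversal is linear because the number of stacked and visited edges
  never exceeds \<open>n\<close>, sorting takes \<open>O(n log n)\<close> steps, and each of the \<open>O(log n)\<close> rounds of the
  search evaluates \<open>f\<close> twice, in linear time.
\<close>

section \<open>Values and running times\<close>

lemma val_bind [simp]: "val (bind_tm m g) = val (g (val m))"
  by (simp add: bind_tm_def split: tm.split)

lemma time_bind [simp]: "time (bind_tm m g) = time m + time (g (val m))"
  by (simp add: bind_tm_def split: tm.split)

lemma val_time_ops [simp]: "val (ops k x) = x" "time (ops k x) = k"
  by (simp_all add: ops_def)

lemma val_time_rd [simp]: "val (rd xs i) = xs ! i" "time (rd xs i) = 1"
  by (simp_all add: rd_def)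

lemma val_time_wr [simp]: "val (wr xs i x) = xs[i := x]" "time (wr xs i x) = 1"
  by (simp_all add: wr_def)

lemma val_time_new [simp]: "val (new n x) = replicate n x" "time (new n x) = Suc n"
  by (simp_all add: new_def)

lemma time_bind_le:
  assumes "time m \<le> a" and "\<And>x. x = val m \<Longrightarrow> time (g x) \<le> b"
  shows "time (bind_tm m g) \<le> a + b"
  using assms by (simp add: add_mono)

lemma val_for_each: "val (for_each xs g s) = fold (\<lambda>x s. val (g x s)) xs s"
  by (induction xs arbitrary: s) simp_all

lemma time_for_each_le:
  assumes "\<And>x s. x \<in> set xs \<Longrightarrow> time (g x s) \<le> k"
  shows "time (for_each xs g s) \<le> (k + 1) * length xs + 1"
  using assms
proof (induction xs arbitrary: s)
  case (Cons x xs)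
  have "time (g x s) \<le> k" "time (for_each xs g s') \<le> (k + 1) * length xs + 1" for s'
    using Cons by auto
  from this(1) this(2)[of "val (g x s)"] show ?case by simp
qed simp

text \<open>The argument \<open>\<tau>\<close> of the invariant is the time spent so far, loop control included.\<close>

lemma for_each_invariant:
  assumes "P 0 0 s"
    and "\<And>i \<tau> s. i < length xs \<Longrightarrow> P i \<tau> s \<Longrightarrow>
           P (Suc i) (Suc (\<tau> + time (g (xs ! i) s))) (val (g (xs ! i) s))"
  shows "\<exists>\<tau>. time (for_each xs g s) = Suc \<tau> \<and> P (length xs) \<tau> (val (for_each xs g s))"
proof -
  \<comment> \<open>Generalized to suffixes of \<open>xs\<close>, so that the induction on the list
    keeps track of the index \<open>i\<close> and of the time already spent.\<close>
  have "\<exists>\<tau>'. \<tau> + time (for_each ys g s) = Suc \<tau>' \<and> P (length xs) \<tau>' (val (for_each ys g s))"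
    if "ys = drop i xs" "i \<le> length xs" "P i \<tau> s" for ys i \<tau> s
    using that
  proof (induction ys arbitrary: i \<tau> s)
    case (Cons y ys)
    then have i: "i < length xs" by (metis drop_eq_Nil2 list.distinct(1) not_le)
    with Cons.prems(1) have y: "y = xs ! i" "ys = drop (Suc i) xs"
      by (simp_all flip: Cons_nth_drop_Suc)
    from Cons.IH[OF y(2) _ assms(2)[OF i Cons.prems(3)]] i show ?case
      by (simp add: y(1) algebra_simps)
  qed simp
  from this[of xs 0 0 s] assms(1) show ?thesis by simp
qed

lemma val_tabulate [simp]: "val (tabulate n g) = map (\<lambda>i. val (g i)) [0..<n]"
proof -
  have "val (for_each [0..<k] (\<lambda>i xs. do { x \<leftarrow> g i; wr xs i x }) (replicate n 0)) =
      map (\<lambda>i. val (g i)) [0..<k] @ replicate (n - k) 0" if "k \<le> n" for k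
    using that
  proof (induction k)
    case (Suc k)
    then show ?case
      by (simp add: val_for_each nth_append list_update_append Suc_diff_Suc [symmetric])
  qed (simp add: val_for_each)
  from this[of n] show ?thesis by (simp add: tabulate_def)
qed

text \<open>Besides \<open>k\<close>, each index pays for the initialization of its cell, one write
  and the loop control.\<close>

lemma time_tabulate_le:
  assumes "\<And>i. time (g i) \<le> k"
  shows "time (tabulate n g) \<le> (k + 3) * n + 2"
  using time_for_each_le[of "[0..<n]" "\<lambda>i xs. do { x \<leftarrow> g i; wr xs i x }" "k + 1" "replicate n 0"]
  by (simp add: tabulate_def assms algebra_simps)

lemma val_total [simp]: "val (total n g) = (\<Sum>i<n. val (g i))"
proof -
  have "fold (\<lambda>x s. s + h x) [0..<n] (0 :: real) = (\<Sum>i<n. h i)" for h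
    by (induction n) simp_all
  then show ?thesis by (simp add: total_def val_for_each)
qed

lemma time_total_le:
  assumes "\<And>i. time (g i) \<le> k"
  shows "time (total n g) \<le> (k + 2) * n + 1"
  using time_for_each_le[of "[0..<n]" "\<lambda>i s. do { x \<leftarrow> g i; op (s + x) }" "k + 1" 0]
  by (simp add: total_def assms algebra_simps)


section \<open>Merge sort\<close>

lemma time_merge_by: "time (merge_by F xs ys) \<le> 4 * (length xs + length ys) + 1"
  by (induction F xs ys rule: merge_by.induct) auto

lemma mset_merge_by: "mset (val (merge_by F xs ys)) = mset xs + mset ys"
  by (induction F xs ys rule: merge_by.induct) auto

lemma sorted_merge_by:
  assumes "sorted (map ((!) F) xs)" "sorted (map ((!) F) ys)"
  shows "sorted (map ((!) F) (val (merge_by F xs ys)))"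
  using assms
proof (induction F xs ys rule: merge_by.induct)
  case (3 F x xs y ys)
  have "set (val (merge_by F as bs)) = set as \<union> set bs" for as bs
    using mset_merge_by[of F as bs] by (metis set_mset_mset set_mset_union)
  with 3 show ?case by auto
qed auto

lemma mset_sort_by: "mset (val (sort_by F xs)) = mset xs"
proof (induction F xs rule: sort_by.induct)
  case (3 F x y zs)
  let ?xs = "x # y # zs"
  have "mset (val (sort_by F ?xs)) = mset (fst (val (halve ?xs))) + mset (snd (val (halve ?xs)))"
    using 3 by (simp add: mset_merge_by)
  also have "\<dots> = mset (take (length ?xs div 2) ?xs @ drop (length ?xs div 2) ?xs)"
    unfolding halve_def by (simp only: mset_append val_time_ops fst_conv snd_conv)
  finally show ?case by simp
qed simp_all

lemma sorted_sort_by: "sorted (map ((!) F) (val (sort_by F xs)))"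
  by (induction F xs rule: sort_by.induct) (simp_all add: sorted_merge_by)

text \<open>On each of the \<open>d\<close> levels, halving costs \<open>3\<close> and merging
  \<open>4\<close> steps per element. The eighth step absorbs the additive constants, since a list
  that is split has at least two elements.\<close>

lemma time_sort_by: "length xs \<le> 2 ^ d \<Longrightarrow> time (sort_by F xs) \<le> 8 * length xs * d + 1"
proof (induction F xs arbitrary: d rule: sort_by.induct)
  case (3 F x y zs)
  let ?xs = "x # y # zs"
  let ?h = "val (halve ?xs)"
  obtain d' where d: "d = Suc d'" using 3(3) by (cases d) auto
  have len: "length (fst ?h) + length (snd ?h) = length ?xs"
    by (simp add: length_halve)
  have small: "length (fst ?h) \<le> 2 ^ d'" "length (snd ?h) \<le> 2 ^ d'"
    using 3(3) by (auto simp: length_halve d)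
  have len_val: "length (val (sort_by F ws)) = length ws" for ws
    by (metis mset_sort_by size_mset)
  have "time (sort_by F ?xs) \<le> 3 * length ?xs + (8 * length (fst ?h) * d' + 1)
      + (8 * length (snd ?h) * d' + 1) + (4 * length ?xs + 1)"
    using 3(1)[OF refl small(1)] 3(2)[OF refl refl small(2)]
      time_merge_by[of F "val (sort_by F (fst ?h))" "val (sort_by F (snd ?h))"] len
    by (simp add: len_val halve_def)
  also have "\<dots> = 7 * length ?xs + 8 * (length (fst ?h) + length (snd ?h)) * d' + 3"
    by (simp only: algebra_simps)
  also have "\<dots> \<le> 8 * length ?xs * d + 1" unfolding len by (simp add: d)
  finally show ?case .
qed simp_all


section \<open>Binary search\<close>

declare search.simps [simp del]

lemma search_stop:
  assumes "\<not> (1 < b - a \<and> kstar = 0)"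
  shows "search f \<Delta> a b kstar = TM kstar 4"
  using assms by (subst search.simps) (auto simp: bind_tm_def ops_def)

lemma search_step:
  assumes "1 < b - a"
  defines "k \<equiv> (a + b) div 2"
  shows "val (search f \<Delta> a b 0) =
      (if val (f k) \<le> \<Delta> \<and> \<Delta> \<le> val (f (k + 1)) then k
       else if val (f (k + 1)) < \<Delta> then val (search f \<Delta> k b 0) else val (search f \<Delta> a k 0))"
    and "time (search f \<Delta> a b 0) = 11 + time (f k) + time (f (k + 1)) +
      (if val (f k) \<le> \<Delta> \<and> \<Delta> \<le> val (f (k + 1)) then 4
       else if val (f (k + 1)) < \<Delta> then time (search f \<Delta> k b 0) else time (search f \<Delta> a k 0))"
proof -
  \<comment> \<open>A hit is signalled by a nonzero \<open>kstar\<close>; it ends the loop only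
    because the midpoint is positive.\<close>
  have "k > 0" using assms by simp
  then have "search f \<Delta> a' b' k = TM k 4" for a' b' by (intro search_stop) simp
  then show "val (search f \<Delta> a b 0) =
      (if val (f k) \<le> \<Delta> \<and> \<Delta> \<le> val (f (k + 1)) then k
       else if val (f (k + 1)) < \<Delta> then val (search f \<Delta> k b 0) else val (search f \<Delta> a k 0))"
    and "time (search f \<Delta> a b 0) = 11 + time (f k) + time (f (k + 1)) +
      (if val (f k) \<le> \<Delta> \<and> \<Delta> \<le> val (f (k + 1)) then 4
       else if val (f (k + 1)) < \<Delta> then time (search f \<Delta> k b 0) else time (search f \<Delta> a k 0))"
    using assms(1) by (subst search.simps; simp flip: k_def)+
qed

text \<open>Both halves of an interval of length at most \<open>2 ^ Suc d\<close> have length at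
  most \<open>2 ^ d\<close>, so \<open>d\<close> bounds the number of rounds. A round costs
  \<open>11\<close> steps and two evaluations of \<open>f\<close>.\<close>

lemma time_search:
  assumes "\<And>k. time (f k) \<le> \<tau>" and "b - a \<le> 2 ^ d"
  shows "time (search f \<Delta> a b 0) \<le> 8 + d * (11 + 2 * \<tau>)"
  using assms(2)
proof (induction d arbitrary: a b)
  case 0
  then show ?case by (simp add: search_stop)
next
  case (Suc d)
  let ?k = "(a + b) div 2"
  show ?case
  proof (cases "1 < b - a")
    case True
    have "time (search f \<Delta> ?k b 0) \<le> 8 + d * (11 + 2 * \<tau>)"
      and "time (search f \<Delta> a ?k 0) \<le> 8 + d * (11 + 2 * \<tau>)"
      using Suc.prems by (auto intro!: Suc.IH)
    with assms(1)[of ?k] assms(1)[of "?k + 1"] show ?thesis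
      unfolding search_step(2)[OF True] by auto
  qed (simp add: search_stop)
qed

text \<open>This holds for every \<open>f\<close> and \<open>\<Delta>\<close>, so the algorithm can
  be evaluated symbolically before the cases of \<open>D\<close> are separated.\<close>

lemma search_le: "val (search f \<Delta> a b 0) \<le> b"
proof (induction "b - a" arbitrary: a b rule: less_induct)
  case less
  show ?case
  proof (cases "1 < b - a")
    case True
    define k where "k = (a + b) div 2"
    have k: "a < k" "k < b" using True by (auto simp: k_def)
    then have "val (search f \<Delta> k b 0) \<le> b" "val (search f \<Delta> a k 0) \<le> k"
      by (auto intro!: less.hyps)
    with k show ?thesis
      unfolding search_step(1)[OF True, folded k_def] by auto
  qed (simp add: search_stop)
qed

lemma search_result:
  fixes f :: "nat \<Rightarrow> real tm"
  assumes "\<Delta> \<le> val (f n)" and "a0 < n"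
  defines "k \<equiv> val (search f \<Delta> a0 n 0)"
  shows "a0 < k \<and> k < n \<and> val (f k) \<le> \<Delta> \<and> \<Delta> \<le> val (f (k + 1)) \<or>
    k = 0 \<and> (n = a0 + 1 \<or> \<Delta> < val (f (a0 + 1)))"
proof -
  \<comment> \<open>If the test at \<open>k\<close> fails and \<open>f (k + 1)\<close> is not below
    \<open>\<Delta>\<close>, then \<open>\<Delta> < f k\<close>; so the new end of the interval
    satisfies its condition again.\<close>
  have "a0 < k \<and> k < n \<and> val (f k) \<le> \<Delta> \<and> \<Delta> \<le> val (f (k + 1)) \<or>
      k = 0 \<and> (n = a0 + 1 \<or> \<Delta> < val (f (a0 + 1)))"
    if "k = val (search f \<Delta> a b 0)" "a0 \<le> a" "a < b" "b \<le> n"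
      "a = a0 \<or> val (f (a + 1)) < \<Delta>" "b = n \<or> \<Delta> < val (f b)" for a b k
    using that
  proof (induction "b - a" arbitrary: a b k rule: less_induct)
    case less
    show ?case
    proof (cases "1 < b - a")
      case True
      define k' where "k' = (a + b) div 2"
      have k': "a < k'" "k' < b" using True by (auto simp: k'_def)
      show ?thesis
        using less.prems(1) less.hyps[of b k' k] less.hyps[of k' a k] less.prems(2-) k'
        unfolding search_step(1)[OF True, folded k'_def]
        by (auto split: if_splits)
    next
      case False
      then have b: "b = a + 1" and k: "k = 0"
        using less.prems by (auto simp: search_stop)
      \<comment> \<open>Otherwise \<open>f b\<close>, where \<open>b = a + 1\<close>, would be below
        \<open>\<Delta>\<close>, against the condition on \<open>b\<close> or the assumption on
        \<open>f n\<close>.\<close>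
      have "a = a0" using less.prems(5,6) assms(1) b by fastforce
      then show ?thesis using less.prems(6) b k by auto
    qed
  qed
  from this[of k a0 n] assms show ?thesis by auto
qed

section \<open>Rooted trees\<close>

locale arborescence = fin_digraph G for G (structure) +
  fixes s
  assumes root_in_verts: "s \<in> verts G"
    and unique_awalk: "v \<in> verts G \<Longrightarrow> \<exists>!p. awalk s p v"

lemma arborescence_iff_rooted_tree: "arborescence T s \<longleftrightarrow> rooted_tree T s"
  by (auto simp: arborescence_def arborescence_axioms_def rooted_tree_def)

context arborescence
begin

lemma root_awalk: "v \<in> verts G \<Longrightarrow> \<exists>p. awalk s p v"
  using unique_awalk by blast

lemma awalk_eq: "awalk s p v \<Longrightarrow> awalk s q v \<Longrightarrow> p = q"
  using unique_awalk awalk_last_in_verts by blast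

lemma awalk_trans: "awalk a p b \<Longrightarrow> awalk b q c \<Longrightarrow> awalk a (p @ q) c"
  by simp

text \<open>The root walk to the tail extends by \<open>e\<close>. By uniqueness \<open>e\<close> is
  the last arc of the only root walk to its head, so heads differ from the root and from each
  other.\<close>

lemma root_awalk_to_head:
  assumes "e \<in> arcs G"
  obtains p where "awalk s (p @ [e]) (head G e)"
  using root_awalk[of "tail G e"] assms arc_implies_awalk awalk_trans tail_in_verts by metis

lemma head_neq_root: "e \<in> arcs G \<Longrightarrow> head G e \<noteq> s"
  using root_awalk_to_head[of e] awalk_eq awalk_Nil_iff root_in_verts by (metis snoc_eq_iff_butlast)

lemma inj_on_head: "inj_on (head G) (arcs G)"
  by (rule inj_onI) (metis root_awalk_to_head awalk_eq last_snoc)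

lemma verts_subsetI:
  assumes "s \<in> S" "\<And>e. e \<in> arcs G \<Longrightarrow> tail G e \<in> S \<Longrightarrow> head G e \<in> S"
  shows "verts G \<subseteq> S"
proof
  fix v assume "v \<in> verts G"
  then obtain p where "awalk s p v" using root_awalk by blast
  moreover have "awalk a p v \<Longrightarrow> a \<in> S \<Longrightarrow> v \<in> S" for a
    by (induction p arbitrary: a) (auto simp: awalk_simps assms(2))
  ultimately show "v \<in> S" using assms(1) by blast
qed

lemma root_path_eq: "awalk s p v \<Longrightarrow> root_path G s v = set p"
  unfolding root_path_def using awalk_eq by (metis the_equality)

lemma finite_leaf_nodes: "finite (leaf_nodes G)"
  by (simp add: leaf_nodes_def)

lemma finite_leaves_through [simp]: "finite (leaves_through G s e)"
  by (simp add: leaves_through_def finite_leaf_nodes)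

lemma root_path_subset: "v \<in> verts G \<Longrightarrow> root_path G s v \<subseteq> arcs G"
  using root_awalk root_path_eq by blast

text \<open>Appending a walk from the head of \<open>e\<close> to the root walk ending with
  \<open>e\<close> gives the only root walk to \<open>t\<close>. Membership in a root path thus
  becomes reachability, which admits recursion over arcs.\<close>

lemma mem_leaves_through_iff:
  assumes e: "e \<in> arcs G"
  shows "t \<in> leaves_through G s e \<longleftrightarrow> t \<in> leaf_nodes G \<and> (\<exists>q. awalk (head G e) q t)"
proof -
  have "e \<in> root_path G s t \<longleftrightarrow> (\<exists>q. awalk (head G e) q t)" if t: "t \<in> verts G"
  proof
    obtain p where p: "awalk s p t" using root_awalk[OF t] by blast
    assume "e \<in> root_path G s t"
    then obtain p1 p2 where "p = p1 @ e # p2"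
      using root_path_eq[OF p] by (metis split_list)
    with p show "\<exists>q. awalk (head G e) q t" by (auto simp: awalk_Cons_iff)
  next
    obtain p where p: "awalk s (p @ [e]) (head G e)" using root_awalk_to_head[OF e] .
    assume "\<exists>q. awalk (head G e) q t"
    then obtain q where "awalk (head G e) q t" by blast
    from root_path_eq[OF awalk_trans[OF p this]] show "e \<in> root_path G s t" by simp
  qed
  then show ?thesis by (auto simp: leaves_through_def leaf_nodes_def)
qed

lemma card_leaves_through_leaf:
  assumes "e \<in> arcs G" "out_arcs G (head G e) = {}"
  shows "card (leaves_through G s e) = 1"
proof -
  have "awalk (head G e) q t \<longleftrightarrow> q = [] \<and> t = head G e" for q t
    using assms by (cases q) (auto simp: awalk_simps)
  then have "leaves_through G s e = {head G e}"
    using assms by (auto simp: mem_leaves_through_iff leaf_nodes_def)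
  then show ?thesis by simp
qed

text \<open>The first arc of the walk from the head to a leaf selects a child edge. Two different
  first arcs would yield two root walks to the same leaf, so the union is disjoint.\<close>

lemma card_leaves_through_inner:
  assumes e: "e \<in> arcs G" and inner: "out_arcs G (head G e) \<noteq> {}"
  shows "card (leaves_through G s e) = (\<Sum>a\<in>out_arcs G (head G e). card (leaves_through G s a))"
proof -
  let ?O = "out_arcs G (head G e)"
  obtain p where p: "awalk s (p @ [e]) (head G e)" using root_awalk_to_head[OF e] .
  have "leaves_through G s e = (\<Union>a\<in>?O. leaves_through G s a)"
  proof (intro set_eqI iffI)
    fix t assume "t \<in> leaves_through G s e"
    then obtain q where t: "t \<in> leaf_nodes G" and q: "awalk (head G e) q t"
      using mem_leaves_through_iff[OF e] by blast
    have "q \<noteq> []" using q t inner by (auto simp: awalk_Nil_iff leaf_nodes_def)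
    then obtain a q' where "q = a # q'" by (cases q) auto
    with q have "a \<in> ?O" "awalk (head G a) q' t" by (auto simp: awalk_simps)
    with t show "t \<in> (\<Union>a\<in>?O. leaves_through G s a)"
      by (auto simp: mem_leaves_through_iff)
  next
    fix t assume "t \<in> (\<Union>a\<in>?O. leaves_through G s a)"
    then obtain a q where "a \<in> arcs G" "tail G a = head G e" "awalk (head G a) q t"
      "t \<in> leaf_nodes G" by (auto simp: mem_leaves_through_iff)
    then have "awalk (head G e) (a # q) t" by (auto simp: awalk_simps)
    with \<open>t \<in> leaf_nodes G\<close> show "t \<in> leaves_through G s e"
      using mem_leaves_through_iff[OF e] by blast
  qed
  moreover have "leaves_through G s a \<inter> leaves_through G s b = {}"
    if ab: "a \<in> ?O" "b \<in> ?O" "a \<noteq> b" for a b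
  proof (rule ccontr)
    assume "\<not> ?thesis"
    then obtain t qa qb where "awalk (head G a) qa t" "awalk (head G b) qb t"
      using ab by (auto simp: mem_leaves_through_iff)
    then have "awalk (head G e) (a # qa) t" "awalk (head G e) (b # qb) t"
      using ab by (auto simp: awalk_simps)
    from awalk_eq[OF awalk_trans[OF p this(1)] awalk_trans[OF p this(2)]] ab(3)
    show False by simp
  qed
  moreover have "finite ?O" by (rule finite_subset[of _ "arcs G"]) auto
  ultimately show ?thesis by (simp add: card_UN_disjoint)
qed

text \<open>Double counting of the pairs of a leaf and an arc on its root path.\<close>

lemma srd_eq: "srd G s x = (\<Sum>e\<in>arcs G. real (card (leaves_through G s e)) * x e)"
proof -
  have "srd G s x = (\<Sum>t\<in>leaf_nodes G. \<Sum>e\<in>{e\<in>arcs G. e \<in> root_path G s t}. x e)"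
    unfolding srd_def
  proof (intro sum.cong refl arg_cong[where f = "sum x"])
    fix t assume "t \<in> leaf_nodes G"
    then show "root_path G s t = {e \<in> arcs G. e \<in> root_path G s t}"
      using root_path_subset by (auto simp: leaf_nodes_def)
  qed
  also have "\<dots> = (\<Sum>e\<in>arcs G. \<Sum>t\<in>{t\<in>leaf_nodes G. e \<in> root_path G s t}. x e)"
    by (rule sum.swap_restrict) (auto simp: finite_leaf_nodes)
  finally show ?thesis by (simp add: leaves_through_def)
qed

end


section \<open>Counting the leaves below every edge\<close>

lemma sum_set_conv_nth: "distinct es \<Longrightarrow> (\<Sum>e\<in>set es. g e) = (\<Sum>i<length es. g (es ! i))"
  by (simp add: sum.distinct_set_conv_list sum_list_sum_nth atLeast0LessThan)

locale tree_list =
  fixes es :: "(nat \<times> nat) list"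
  assumes tree: "rooted_tree (tree_of es) 0" and distinct: "distinct es"
begin

sublocale arborescence "tree_of es" 0
  using tree by (simp add: arborescence_iff_rooted_tree)

abbreviation n :: nat where "n \<equiv> length es"
abbreviation parent :: "nat \<Rightarrow> nat" where "parent i \<equiv> fst (es ! i)"
abbreviation child :: "nat \<Rightarrow> nat" where "child i \<equiv> snd (es ! i)"
abbreviation below :: "nat \<times> nat \<Rightarrow> nat" where "below e \<equiv> card (leaves_through (tree_of es) 0 e)"

lemma tree_of_simps [simp]:
  "verts (tree_of es) = {0..n}" "arcs (tree_of es) = set es"
  "tail (tree_of es) = fst" "head (tree_of es) = snd"
  by (simp_all add: tree_of_def)

lemma parent_le: "i < n \<Longrightarrow> parent i \<le> n"
  using tail_in_verts[of "es ! i"] by simp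

lemma child_le: "i < n \<Longrightarrow> child i \<le> n"
  using head_in_verts[of "es ! i"] by simp

lemma child_pos: "i < n \<Longrightarrow> 0 < child i"
  using head_neq_root[of "es ! i"] by simp

lemma child_eq_iff: "i < n \<Longrightarrow> j < n \<Longrightarrow> child i = child j \<longleftrightarrow> i = j"
  using inj_on_head by (auto simp: inj_on_eq_iff nth_eq_iff_index_eq distinct)

lemma out_arcs_eq: "out_arcs (tree_of es) v = (!) es ` {i. i < n \<and> parent i = v}"
  by (auto simp: out_arcs_def in_set_conv_nth image_iff) force+

lemma below_eq:
  assumes "i < n"
  shows "below (es ! i) = (if \<forall>j<n. parent j \<noteq> child i then 1
    else \<Sum>j | j < n \<and> parent j = child i. below (es ! j))"
proof -
  have e: "es ! i \<in> arcs (tree_of es)" using assms by simp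
  have "inj_on ((!) es) {j. j < n \<and> parent j = child i}"
    by (auto simp: inj_on_def nth_eq_iff_index_eq distinct)
  then show ?thesis
    using card_leaves_through_leaf[OF e] card_leaves_through_inner[OF e]
    by (auto simp: out_arcs_eq sum.reindex)
qed

text \<open>Reversed because \<open>child_edges\<close> scans the indices upwards and pushes each
  one to the front.\<close>

definition children :: "nat \<Rightarrow> nat list" where
  "children v = rev (filter (\<lambda>i. parent i = v) [0..<n])"

lemma set_children [simp]: "set (children v) = {i. i < n \<and> parent i = v}"
  by (auto simp: children_def)

lemma distinct_children: "distinct (children v)"
  by (simp add: children_def)

definition chs :: "nat list list" where
  "chs = map children [0..<Suc n]"

lemma chs_nth: "v \<le> n \<Longrightarrow> chs ! v = children v"
  using nth_map_upt[of v "Suc n" 0 children] by (simp add: chs_def)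

lemma val_child_edges: "val (child_edges es) = chs"
proof -
  define step where "step i ch = ch[parent i := i # ch ! parent i]" for i and ch :: "nat list list"
  have "length (fold step [0..<k] (replicate (Suc n) [])) = Suc n \<and>
      (\<forall>v\<le>n. fold step [0..<k] (replicate (Suc n) []) ! v = rev (filter (\<lambda>i. parent i = v) [0..<k]))"
    if "k \<le> n" for k
    using that
  proof (induction k)
    case 0
    then show ?case by (simp add: nth_Cons split: nat.split)
  next
    case (Suc k)
    have "fold step [0..<Suc k] xs = step k (fold step [0..<k] xs)" for xs by simp
    with Suc parent_le[of k] show ?case
      by (auto simp: step_def nth_list_update simp del: replicate_Suc)
  qed
  from this[of n] have "fold step [0..<n] (replicate (Suc n) []) = chs"
    by (intro nth_equalityI) (auto simp: chs_def chs_nth[unfolded chs_def] children_def less_Suc_eq_le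
      simp del: upt_Suc replicate_Suc)
  then show ?thesis
    by (simp add: child_edges_def val_for_each case_prod_beta step_def [abs_def])
qed

lemma time_child_edges: "time (child_edges es) \<le> 5 * n + 1 + (n + 2)"
  using time_for_each_le[of "[0..<n]" "\<lambda>i ch. do { (p, v) \<leftarrow> rd es i; l \<leftarrow> rd ch p; l' \<leftarrow> op (i # l); wr ch p l' }" 4
      "replicate (Suc n) []"]
  by (simp add: child_edges_def case_prod_beta)

section \<open>The traversal of the edges and its order\<close>

lemma parent_neq_child:
  assumes "i < n"
  shows "parent i \<noteq> child i"
proof
  assume *: "parent i = child i"
  have e: "es ! i \<in> arcs (tree_of es)" using assms by simp
  obtain p where p: "awalk 0 (p @ [es ! i]) (child i)" using root_awalk_to_head[OF e] by auto
  have "awalk (child i) [es ! i] (child i)" using arc_implies_awalk[OF e] * by simp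
  from awalk_eq[OF p awalk_trans[OF p this]] show False by simp
qed

text \<open>The last conjunct says that every visited edge is preceded by the visited edges below it.\<close>

definition explored :: "nat list \<Rightarrow> nat list \<Rightarrow> bool" where
  "explored stack visited \<longleftrightarrow>
     distinct (stack @ visited) \<and>
     (\<forall>j. j \<in> set (stack @ visited) \<longleftrightarrow> j < n \<and> parent j \<in> insert 0 (child ` set visited)) \<and>
     sorted_wrt (\<lambda>i j. parent j \<noteq> child i) visited"

lemma explored_start: "explored (children 0) []"
  by (auto simp: explored_def distinct_children)

text \<open>Visiting \<open>i\<close> adds the node \<open>child i\<close>, which is neither the
  root nor the child of a visited edge; hence the edges leaving it are new to both lists.\<close>

lemma explored_step:
  assumes "explored (i # rest) visited"
  shows "explored (rev (children (child i)) @ rest) (i # visited)"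
proof -
  have mem: "j \<in> set (i # rest @ visited) \<longleftrightarrow> j < n \<and> parent j \<in> insert 0 (child ` set visited)" for j
    using assms by (simp add: explored_def)
  have i: "i < n" "i \<notin> set visited" using assms mem[of i] by (auto simp: explored_def)
  have "j < n" if "j \<in> set visited" for j using mem[of j] that by simp
  with i have fresh: "child i \<notin> child ` set visited" using child_eq_iff by auto
  have new: "parent j \<noteq> child i" if "j \<in> set (i # rest @ visited)" for j
    using mem[of j] that fresh child_pos[OF i(1)] by (metis insert_iff less_irrefl)
  have old: "distinct (i # rest @ visited)" "sorted_wrt (\<lambda>i j. parent j \<noteq> child i) visited"
    using assms by (simp_all add: explored_def)
  show ?thesis
    unfolding explored_def
  proof (intro conjI allI)
    have "set (children (child i)) \<inter> set (i # rest @ visited) = {}"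
      using new unfolding set_children by blast
    then show "distinct ((rev (children (child i)) @ rest) @ i # visited)"
      using old(1) distinct_children by auto
    show "j \<in> set ((rev (children (child i)) @ rest) @ i # visited) \<longleftrightarrow>
        j < n \<and> parent j \<in> insert 0 (child ` set (i # visited))" for j
      using mem[of j] by auto
    show "sorted_wrt (\<lambda>i j. parent j \<noteq> child i) (i # visited)"
      using old(2) new by simp
  qed
qed

text \<open>With an empty stack the reached nodes are closed under edges, so they are all
  \<open>n + 1\<close> nodes; but fewer than \<open>n\<close> visited edges reach at most
  \<open>n\<close> nodes, the root included.\<close>

lemma explored_not_done:
  assumes "explored stack visited" "length visited < n"
  shows "stack \<noteq> []"
proof
  assume "stack = []"
  then have mem: "j \<in> set visited \<longleftrightarrow> j < n \<and> parent j \<in> insert 0 (child ` set visited)" for j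
    using assms(1) by (simp only: explored_def append_Nil)
  have "verts (tree_of es) \<subseteq> insert 0 (child ` set visited)"
  proof (rule verts_subsetI)
    fix e assume "e \<in> arcs (tree_of es)"
      and "tail (tree_of es) e \<in> insert 0 (child ` set visited)"
    then obtain j where "j < n" "e = es ! j" "parent j \<in> insert 0 (child ` set visited)"
      by (auto simp: in_set_conv_nth)
    with mem[of j] show "head (tree_of es) e \<in> insert 0 (child ` set visited)" by simp
  qed simp
  then have "card {0..n} \<le> card (insert 0 (child ` set visited))"
    by (intro card_mono) auto
  also have "\<dots> \<le> Suc (card (child ` set visited))" by (rule card_insert_le_m1) auto
  also have "card (child ` set visited) \<le> card (set visited)" by (intro card_image_le) simp
  also have "\<dots> \<le> length visited" by (rule card_length)
  finally show False using assms(2) by simp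
qed

lemma explored_done:
  assumes "explored stack visited" "length visited = n"
  shows "set visited = {..<n}" "distinct visited" "sorted_wrt (\<lambda>i j. parent j \<noteq> child i) visited"
proof -
  show "distinct visited" "sorted_wrt (\<lambda>i j. parent j \<noteq> child i) visited"
    using assms by (auto simp: explored_def)
  moreover have "set visited \<subseteq> {..<n}" using assms(1) by (auto simp: explored_def)
  ultimately show "set visited = {..<n}"
    using assms(2) by (intro card_subset_eq) (auto simp: distinct_card)
qed

lemma visit_Cons:
  assumes "i < n"
  shows "val (visit es chs (i # rest, visited)) = (rev (children (child i)) @ rest, i # visited)"
    and "time (visit es chs (i # rest, visited)) = 4 + 2 * length (children (child i))"
proof -
  have push: "val (for_each l (\<lambda>j st. op (j # st)) st) = rev l @ st"
    "time (for_each l (\<lambda>j st. op (j # st)) st) = 2 * length l + 1" for l st :: "nat list"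
    by (induction l arbitrary: st) simp_all
  show "val (visit es chs (i # rest, visited)) = (rev (children (child i)) @ rest, i # visited)"
    "time (visit es chs (i # rest, visited)) = 4 + 2 * length (children (child i))"
    by (simp_all add: visit_def case_prod_beta push[simplified] chs_nth child_le assms)
qed

lemma bottom_up_edges:
  defines "order \<equiv> val (bottom_up_edges es chs)"
  shows "set order = {..<n}" "distinct order" "sorted_wrt (\<lambda>i j. parent j \<noteq> child i) order"
    and "time (bottom_up_edges es chs) \<le> 7 * n + 2"
proof -
  let ?g = "\<lambda>_ :: nat. visit es chs"
  \<comment> \<open>Amortization: a round costs \<open>5\<close> steps, loop control included, and
    \<open>2\<close> per pushed edge, and \<open>stack @ visited\<close> grows by exactly the pushed
    edges.\<close>
  define P where "P k \<tau> = (\<lambda>(stack, visited). explored stack visited \<and> length visited = k \<and>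
      \<tau> \<le> 5 * k + 2 * length (stack @ visited))" for k \<tau>
  have "\<exists>\<tau>. time (for_each [0..<n] ?g (children 0, [])) = Suc \<tau> \<and>
      P (length [0..<n]) \<tau> (val (for_each [0..<n] ?g (children 0, [])))"
  proof (rule for_each_invariant[where P = P])
    show "P 0 0 (children 0, [])" by (simp add: P_def explored_start)
  next
    fix k \<tau> st assume k: "k < length [0..<n]" and P: "P k \<tau> st"
    obtain stack visited where st: "st = (stack, visited)" by (cases st)
    with P k have expl: "explored stack visited" and len: "length visited < n"
      by (auto simp: P_def)
    then obtain i rest where stack: "stack = i # rest"
      using explored_not_done[OF expl len] by (cases stack) auto
    with expl have "i < n" by (auto simp: explored_def)
    then show "P (Suc k) (Suc (\<tau> + time (visit es chs st))) (val (visit es chs st))"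
      using P explored_step expl unfolding st stack
      by (simp add: visit_Cons P_def)
  qed
  then obtain \<tau> where \<tau>: "time (for_each [0..<n] ?g (children 0, [])) = Suc \<tau>"
    and P: "P n \<tau> (val (for_each [0..<n] ?g (children 0, [])))" by auto
  obtain stack visited where sv: "val (for_each [0..<n] ?g (children 0, [])) = (stack, visited)"
    by fastforce
  have order: "order = visited"
    unfolding order_def bottom_up_edges_def by (simp add: chs_nth sv case_prod_beta)
  from P have expl: "explored stack visited" and len: "length visited = n"
    and le: "\<tau> \<le> 5 * n + 2 * length (stack @ visited)" by (simp_all add: P_def sv)
  show "set order = {..<n}" "distinct order" "sorted_wrt (\<lambda>i j. parent j \<noteq> child i) order"
    unfolding order using explored_done[OF expl len] by auto
  \<comment> \<open>Distinct indices below \<open>n\<close> limit the amortized term to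
    \<open>2 * n\<close>.\<close>
  have "distinct (stack @ visited)" "set (stack @ visited) \<subseteq> {..<n}"
    using expl by (auto simp: explored_def)
  then have "length (stack @ visited) \<le> n"
    by (metis card_lessThan card_mono distinct_card finite_lessThan)
  with le \<tau> show "time (bottom_up_edges es chs) \<le> 7 * n + 2"
    unfolding bottom_up_edges_def by (simp add: chs_nth case_prod_beta)
qed

text \<open>Induction along the visiting order, in which the edges leaving \<open>child i\<close>
  precede \<open>i\<close>. Positivity later makes \<open>gain\<close> strictly increasing.\<close>

lemma below_pos:
  assumes "i < n"
  shows "0 < below (es ! i)"
proof -
  let ?order = "val (bottom_up_edges es chs)"
  have "\<forall>i\<in>set xs. 0 < below (es ! i)" if "?order = xs @ ys" for xs ys
    using that
  proof (induction xs arbitrary: ys rule: rev_induct)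
    case (snoc i xs)
    then have IH: "\<forall>j\<in>set xs. 0 < below (es ! j)" and order: "?order = xs @ i # ys" by auto
    have set: "set xs \<union> insert i (set ys) = {..<n}" using bottom_up_edges(1) order by simp
    then have i: "i < n" by auto
    have "0 < below (es ! j)" if "j < n" "parent j = child i" for j
    proof -
      have "sorted_wrt (\<lambda>i j. parent j \<noteq> child i) (xs @ i # ys)"
        using bottom_up_edges(3) order by simp
      \<comment> \<open>The order excludes the edges after \<open>i\<close>; \<open>i\<close> itself
        is excluded because there are no loops.\<close>
      then have "j \<notin> insert i (set ys)"
        using that parent_neq_child[OF i] by (auto simp: sorted_wrt_append)
      with IH set that(1) show ?thesis by auto
    qed
    then have "0 < below (es ! i)"
      by (auto simp: below_eq[OF i] card_gt_0_iff intro!: sum_pos)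
    with IH show ?case by simp
  qed simp
  from this[of ?order "[]"] show ?thesis using bottom_up_edges(1) assms by simp
qed

section \<open>Accumulating the leaf counts\<close>

definition add_leaves :: "nat \<Rightarrow> real list \<times> real list \<Rightarrow> (real list \<times> real list) tm" where
  "add_leaves = (\<lambda>i (bl, L). do {
     (p, v) \<leftarrow> rd es i;
     l \<leftarrow> rd chs v;
     b \<leftarrow> rd bl v;
     k \<leftarrow> op (if l = [] then 1 else b);
     b' \<leftarrow> rd bl p;
     s \<leftarrow> op (b' + k);
     bl' \<leftarrow> wr bl p s;
     L' \<leftarrow> wr L i k;
     ret (bl', L') })"

lemma leaf_counts_eq:
  defines "order \<equiv> val (bottom_up_edges es chs)"
    and "s0 \<equiv> (replicate (Suc n) 0, replicate n 0)"
  shows "val (leaf_counts es) = snd (val (for_each order add_leaves s0))"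
    and "time (leaf_counts es) = time (child_edges es) + time (bottom_up_edges es chs) +
      (2 * n + 3) + time (for_each order add_leaves s0)"
  unfolding order_def s0_def
  by (simp_all only: leaf_counts_def add_leaves_def val_child_edges case_prod_beta val_bind time_bind
    val_time_ops val_time_new)

text \<open>The cell of a node holds the sum over the processed edges leaving it. When
  \<open>i\<close> is processed, all edges leaving \<open>child i\<close> have been processed, so
  the cell of \<open>child i\<close> is complete.\<close>

lemma val_leaf_counts: "val (leaf_counts es) = map (\<lambda>e. real (below e)) es"
proof -
  let ?order = "val (bottom_up_edges es chs)"
  let ?s0 = "(replicate (Suc n) 0, replicate n 0)"
  define P where "P k = (\<lambda>(bl, L). length bl = Suc n \<and> length L = n \<and>
      (\<forall>p\<le>n. bl ! p = (\<Sum>j | j \<in> set (take k ?order) \<and> parent j = p. real (below (es ! j)))) \<and>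
      (\<forall>j\<in>set (take k ?order). L ! j = real (below (es ! j))))" for k
  have "\<exists>\<tau>. time (for_each ?order add_leaves ?s0) = Suc \<tau> \<and>
      P (length ?order) (val (for_each ?order add_leaves ?s0))"
  proof (rule for_each_invariant[where P = "\<lambda>k \<tau>. P k"])
    show "P 0 ?s0" by (simp add: P_def nth_Cons split: nat.split)
  next
    fix k \<tau> st assume k: "k < length ?order" and P: "P k st"
    obtain bl L where st: "st = (bl, L)" by (cases st)
    define i where "i = ?order ! k"
    have order: "?order = take k ?order @ i # drop (Suc k) ?order"
      using k by (simp add: i_def id_take_nth_drop)
    have take: "take (Suc k) ?order = take k ?order @ [i]"
      using k by (simp add: i_def take_Suc_conv_app_nth)
    have i: "i < n" using bottom_up_edges(1) k nth_mem by (auto simp: i_def)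
    have fresh: "i \<notin> set (take k ?order)"
      using bottom_up_edges(2) order by (metis distinct_append distinct.simps(2) not_distinct_conv_prefix)
    have "{j. j \<in> set (take k ?order) \<and> parent j = child i} = {j. j < n \<and> parent j = child i}"
    proof -
      have "j \<in> set (take k ?order)" if "j < n" "parent j = child i" for j
      proof -
        have "j \<in> set (take k ?order @ i # drop (Suc k) ?order)"
          using that(1) bottom_up_edges(1) order by (metis lessThan_iff)
        moreover have "sorted_wrt (\<lambda>i j. parent j \<noteq> child i) (take k ?order @ i # drop (Suc k) ?order)"
          using bottom_up_edges(3) order by metis
        ultimately show ?thesis
          using that(2) parent_neq_child[OF i] by (auto simp: sorted_wrt_append)
      qed
      moreover have "set (take k ?order) \<subseteq> {..<n}"
        using bottom_up_edges(1) set_take_subset by metis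
      ultimately show ?thesis by auto
    qed
    \<comment> \<open>An empty child list marks a leaf, whose count is \<open>1\<close> although its
      cell contains \<open>0\<close>.\<close>
    then have K: "(if chs ! child i = [] then 1 else bl ! child i) = real (below (es ! i))"
      using P i child_le[OF i]
      by (auto simp: P_def st below_eq chs_nth children_def filter_empty_conv)
    have step: "val (add_leaves i st) =
        (bl[parent i := bl ! parent i + real (below (es ! i))], L[i := real (below (es ! i))])"
      unfolding K [symmetric] st by (simp add: add_leaves_def case_prod_beta)
    have "real (below (es ! i)) + (\<Sum>j | j \<in> set (take k ?order) \<and> parent j = parent i. real (below (es ! j))) =
        (\<Sum>j | j \<in> set (take (Suc k) ?order) \<and> parent j = parent i. real (below (es ! j)))"
    proof -
      have "{j. j \<in> set (take (Suc k) ?order) \<and> parent j = parent i} =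
          insert i {j. j \<in> set (take k ?order) \<and> parent j = parent i}" by (auto simp: take)
      then show ?thesis using fresh by simp
    qed
    moreover have "{j. j \<in> set (take (Suc k) ?order) \<and> parent j = p} =
        {j. j \<in> set (take k ?order) \<and> parent j = p}" if "p \<noteq> parent i" for p
      using that by (auto simp: take)
    ultimately show "P (Suc k) (val (add_leaves (?order ! k) st))"
      using P i parent_le[OF i] fresh
      unfolding i_def[symmetric] step
      by (auto simp: P_def st nth_list_update take)
  qed
  then have "P (length ?order) (val (for_each ?order add_leaves ?s0))" by blast
  then have "snd (val (for_each ?order add_leaves ?s0)) = map (\<lambda>e. real (below e)) es"
    using bottom_up_edges(1) by (auto simp: P_def case_prod_beta intro!: nth_equalityI)
  then show ?thesis
    by (simp add: leaf_counts_eq(1))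
qed

lemma time_leaf_counts: "time (leaf_counts es) \<le> 24 * n + 20"
proof -
  have "length (val (bottom_up_edges es chs)) = n"
    using bottom_up_edges(1,2) by (metis card_lessThan distinct_card)
  then show ?thesis
    using time_child_edges bottom_up_edges(4)
      time_for_each_le[of "val (bottom_up_edges es chs)" add_leaves 8
        "(replicate (Suc n) 0, replicate n 0)"]
    by (simp add: leaf_counts_eq(2) add_leaves_def case_prod_beta)
qed

end

section \<open>Running time of the algorithm\<close>

lemma time_level: "time (level F m k) \<le> 4"
  by (simp add: level_def)

lemma time_eval_f: "time (eval_f L w u c F m k) \<le> 10 * length w + 5"
  unfolding eval_f_def
  using time_level[of F m k]
  by (auto intro!: order_trans[OF add_mono[OF _ time_total_le[where k = 8]]])

context tree_list
begin

lemma time_algorithm_A: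
  assumes len: "length w = n" "length u = n" "length c = n" and d: "n \<le> 2 ^ d"
  shows "time (algorithm_A a0 es w u c D) \<le> 100 * (n + 1) * (d + 1)"
proof -
  \<comment> \<open>One summand per binding in program order, nested as \<open>time_bind_le\<close>
    produces them; \<open>?rest\<close> covers what follows the two early exits.\<close>
  let ?rest = "(n + 1) + ((8 * n * d + 1) + ((n + 1) + ((8 + d * (11 + 2 * (10 * n + 5))) +
      (4 + ((10 * n + 5) + (1 + ((7 * n + 1) + (1 + ((12 * n + 2) + (1 + (1 + 0)))))))))))"
  have "time (algorithm_A a0 es w u c D) \<le> (n + 1) + ((24 * n + 20) + ((8 * n + 2) +
      ((5 * n + 1) + ((5 * n + 1) + (1 + (1 + (1 + ?rest)))))))"
    unfolding algorithm_A_def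
    apply (intro time_bind_le)
    apply (simp_all only: val_time_ops)
    subgoal using time_leaf_counts by simp
    subgoal by (rule order_trans[OF time_tabulate_le[where k = 5]]) simp_all
    subgoal by (rule order_trans[OF time_total_le[where k = 3]]) simp_all
    subgoal by (rule order_trans[OF time_total_le[where k = 3]]) simp_all
    apply (split if_split, intro conjI impI)
    subgoal by simp
    apply (split if_split, intro conjI impI)
    subgoal by simp
    apply (intro time_bind_le)
    apply (simp_all only: val_time_ops)
    subgoal using time_sort_by[of "[0..<n]" d] d by simp
    subgoal using d by (intro time_search) (auto intro: order_trans[OF time_eval_f] simp: len)
    subgoal by (rule time_level)
    subgoal using time_eval_f[of _ w] by (simp add: len)
    subgoal by (rule order_trans[OF time_total_le[where k = 5]]) simp_all
    subgoal by (rule order_trans[OF time_tabulate_le[where k = 9]]) simp_all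
    done
  also have "\<dots> \<le> 100 * (n + 1) * (d + 1)"
    by (simp add: algebra_simps)
  finally show ?thesis .
qed

end

definition log_bound :: "nat \<Rightarrow> nat" where
  "log_bound n = nat \<lceil>log 2 (real n)\<rceil>"

lemma le_two_power_log_bound: "n \<le> 2 ^ log_bound n"
proof (cases "n = 0")
  case False
  have "real n = 2 powr log 2 (real n)" using False by simp
  also have "\<dots> \<le> 2 powr real (log_bound n)"
    unfolding log_bound_def by (intro powr_mono real_nat_ceiling_ge) simp
  also have "\<dots> = real (2 ^ log_bound n)" by (simp add: powr_realpow)
  finally show ?thesis by linarith
qed simp

text \<open>From \<open>n = 2\<close> on, \<open>log 2 n\<close> is at least \<open>1\<close>, so
  rounding up and adding \<open>1\<close> gives at most \<open>3 * log 2 n\<close>, and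
  \<open>n + 1 \<le> 2 * n\<close>. The factor \<open>1 / ln 2\<close> changes the base.\<close>

lemma bigo_log_bound:
  "(\<lambda>n. real (100 * (n + 1) * (log_bound n + 1))) \<in> O(\<lambda>n. real n * ln (real n))"
proof (rule bigoI)
  show "\<forall>\<^sub>F n in sequentially. norm (real (100 * (n + 1) * (log_bound n + 1)))
      \<le> 600 / ln 2 * norm (real n * ln (real n))"
  proof (rule eventually_sequentiallyI)
    fix n :: nat assume n: "2 \<le> n"
    have log: "1 \<le> log 2 (real n)" using n by (simp add: le_log_iff)
    then have "real (log_bound n) \<le> log 2 (real n) + 1"
      unfolding log_bound_def by linarith
    with log have "real (log_bound n + 1) \<le> 3 * log 2 (real n)" by simp
    moreover have "real (100 * (n + 1)) \<le> 200 * real n" using n by simp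
    ultimately have "real (100 * (n + 1)) * real (log_bound n + 1) \<le> 200 * real n * (3 * log 2 (real n))"
      by (intro mult_mono) simp_all
    also have "\<dots> = 600 / ln 2 * norm (real n * ln (real n))"
      using n by (simp add: log_def)
    finally show "norm (real (100 * (n + 1) * (log_bound n + 1))) \<le> 600 / ln 2 * norm (real n * ln (real n))"
      by (simp only: norm_of_nat of_nat_mult [symmetric])
  qed
qed


section \<open>Capped increases\<close>

text \<open>The tree enters only through the positive weights \<open>K e\<close>, which will be the
  leaf counts \<open>|L(e)|\<close>.\<close>

locale capped =
  fixes E :: "'e set" and K w u c :: "'e \<Rightarrow> real"
  assumes finite: "finite E"
    and K_pos: "e \<in> E \<Longrightarrow> 0 < K e"
    and w_le_u: "e \<in> E \<Longrightarrow> w e \<le> u e"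
    and c_pos: "e \<in> E \<Longrightarrow> 0 < c e"
begin

definition F :: "'e \<Rightarrow> real" where
  "F e = c e * (u e - w e)"

definition gain :: "real \<Rightarrow> real" where
  "gain h = (\<Sum>e\<in>E. K e * min (u e - w e) (h / c e))"

definition raise :: "real \<Rightarrow> 'e \<Rightarrow> real" where
  "raise h e = w e + min (u e - w e) (h / c e)"

lemma F_nonneg: "e \<in> E \<Longrightarrow> 0 \<le> F e"
  using w_le_u[of e] c_pos[of e] by (simp add: F_def)

text \<open>This and the next equivalence decide which argument of the minimum in
  \<open>gain\<close> and \<open>raise\<close> is attained.\<close>

lemma F_le_iff: "e \<in> E \<Longrightarrow> F e \<le> h \<longleftrightarrow> u e - w e \<le> h / c e"
  using c_pos[of e] by (simp add: F_def pos_le_divide_eq mult.commute)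

lemma le_F_iff: "e \<in> E \<Longrightarrow> h \<le> F e \<longleftrightarrow> h / c e \<le> u e - w e"
  using c_pos[of e] by (simp add: F_def pos_divide_le_eq mult.commute)

lemma cost_raise: "e \<in> E \<Longrightarrow> c e * (raise h e - w e) = min (F e) h"
  using c_pos[of e] by (simp add: raise_def F_def min_mult_distrib_left)

lemma gain_mono: "h \<le> h' \<Longrightarrow> gain h \<le> gain h'"
  unfolding gain_def
  by (intro sum_mono mult_left_mono min.mono divide_right_mono)
     (auto intro: less_imp_le K_pos c_pos)

lemma gain_zero [simp]: "gain 0 = 0"
  unfolding gain_def using w_le_u by (intro sum.neutral) (force simp: min_def)

text \<open>The edge \<open>e\<close> is not capped before \<open>h'\<close>, so its term grows
  strictly while no other term decreases.\<close>

lemma gain_strict_mono: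
  assumes "h < h'" "e \<in> E" "h' \<le> F e"
  shows "gain h < gain h'"
  unfolding gain_def
proof (rule sum_strict_mono_ex1[OF finite])
  show "\<forall>e\<in>E. K e * min (u e - w e) (h / c e) \<le> K e * min (u e - w e) (h' / c e)"
    using assms(1) by (auto intro!: mult_left_mono min.mono divide_right_mono less_imp_le[OF K_pos] less_imp_le[OF c_pos])
  have "h / c e < h' / c e" using assms(1) c_pos[OF assms(2)] by (simp add: divide_strict_right_mono)
  then have "min (u e - w e) (h / c e) < min (u e - w e) (h' / c e)"
    using assms(2,3) le_F_iff[of e h'] by simp
  then show "\<exists>e\<in>E. K e * min (u e - w e) (h / c e) < K e * min (u e - w e) (h' / c e)"
    using assms(2) K_pos by (metis mult_less_cancel_left_pos)
qed

lemma sum_raise: "(\<Sum>e\<in>E. K e * raise h e) = (\<Sum>e\<in>E. K e * w e) + gain h"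
  by (simp add: raise_def gain_def algebra_simps sum.distrib)

lemma gain_top:
  assumes "\<And>e. e \<in> E \<Longrightarrow> F e \<le> h"
  shows "gain h = (\<Sum>e\<in>E. K e * u e) - (\<Sum>e\<in>E. K e * w e)"
proof -
  have "gain h = (\<Sum>e\<in>E. K e * (u e - w e))"
    unfolding gain_def using assms F_le_iff by (intro sum.cong refl) (simp add: min_def)
  then show ?thesis by (simp add: algebra_simps sum_subtractf)
qed

text \<open>The right-hand side treats every edge as uncapped, and the capped edge \<open>e\<close>
  falls short of that. This refutes the cost reported when the search misses the index
  \<open>1\<close>.\<close>

lemma gain_less_linear:
  assumes "e \<in> E" "F e < h"
  shows "gain h < (\<Sum>e\<in>E. K e / c e) * h"
proof -
  have "gain h < (\<Sum>e\<in>E. K e * (h / c e))"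
    unfolding gain_def
  proof (rule sum_strict_mono_ex1[OF finite])
    show "\<forall>e\<in>E. K e * min (u e - w e) (h / c e) \<le> K e * (h / c e)"
      using K_pos by (intro ballI mult_left_mono min.cobounded2) (auto intro: less_imp_le)
    have "min (u e - w e) (h / c e) < h / c e" using assms le_F_iff[of e h] by simp
    then show "\<exists>e\<in>E. K e * min (u e - w e) (h / c e) < K e * (h / c e)"
      using assms(1) K_pos by (metis mult_less_cancel_left_pos)
  qed
  then show ?thesis by (simp add: sum_distrib_right)
qed

text \<open>Such a \<open>y\<close> lies pointwise below \<open>raise h\<close>.\<close>

lemma gain_le_of_cost_le:
  assumes "\<And>e. e \<in> E \<Longrightarrow> y e \<le> u e" "\<And>e. e \<in> E \<Longrightarrow> c e * (y e - w e) \<le> h"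
  shows "(\<Sum>e\<in>E. K e * y e) \<le> (\<Sum>e\<in>E. K e * w e) + gain h"
  unfolding sum_raise[symmetric]
proof (intro sum_mono mult_left_mono)
  fix e assume e: "e \<in> E"
  then have "y e - w e \<le> h / c e" using assms(2)[of e] c_pos[of e] by (simp add: pos_le_divide_eq mult.commute)
  then show "y e \<le> raise h e" using assms(1)[OF e] by (simp add: raise_def)
  show "0 \<le> K e" using K_pos[OF e] by simp
qed

end

section \<open>Breakpoints in sorted order and interpolation\<close>

locale capped_sorted = capped E K w u c for E :: "'e set" and K w u c +
  fixes es :: "'e list"
  assumes distinct: "distinct es" and set_es: "set es = E" and sorted: "sorted (map F es)"
begin

text \<open>Levels count from \<open>1\<close> and list positions from \<open>0\<close>; level
  \<open>0\<close> encodes the convention for \<open>k\<^sup>* = 0\<close>.\<close>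

definition lev :: "nat \<Rightarrow> real" where
  "lev k = (if k = 0 then 0 else F (es ! (k - 1)))"

text \<open>This is \<open>\<sigma>\<close> for \<open>k\<^sup>* = k\<close>: position
  \<open>k\<close> holds the first edge after the \<open>k\<close> smallest.\<close>

definition slope :: "nat \<Rightarrow> real" where
  "slope k = (\<Sum>j=k..<length es. K (es ! j) / c (es ! j))"

lemma nth_in_E: "j < length es \<Longrightarrow> es ! j \<in> E"
  using set_es nth_mem by blast

lemma F_nth_mono: "i \<le> j \<Longrightarrow> j < length es \<Longrightarrow> F (es ! i) \<le> F (es ! j)"
  using sorted by (auto simp: sorted_iff_nth_mono)

lemma lev_mono: "i \<le> j \<Longrightarrow> j \<le> length es \<Longrightarrow> lev i \<le> lev j"
  using F_nth_mono[of "i - 1" "j - 1"] F_nonneg[OF nth_in_E, of "j - 1"] by (auto simp: lev_def)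

lemma slope_pos:
  assumes "k < length es"
  shows "0 < slope k"
  unfolding slope_def using assms K_pos c_pos nth_in_E by (intro sum_pos) auto

text \<open>On this interval the first \<open>k\<close> edges stay capped and the others stay
  uncapped, so only the latter contribute growth.\<close>

lemma gain_linear:
  assumes "k < length es" "lev k \<le> h" "h \<le> lev (Suc k)"
  shows "gain h = gain (lev k) + (h - lev k) * slope k"
proof -
  define d where "d x j = K (es ! j) * min (u (es ! j) - w (es ! j)) (x / c (es ! j))" for x j
  have split: "gain x = (\<Sum>j<k. d x j) + (\<Sum>j=k..<length es. d x j)" for x
  proof -
    have "gain x = (\<Sum>j<length es. d x j)"
      using sum.distinct_set_conv_list[OF distinct, of "\<lambda>e. K e * min (u e - w e) (x / c e)"]
      by (simp add: gain_def d_def set_es sum_list_sum_nth atLeast0LessThan)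
    also have "\<dots> = (\<Sum>j<k. d x j) + (\<Sum>j=k..<length es. d x j)"
      using sum.atLeastLessThan_concat[of 0 k "length es" "d x"] assms(1)
      by (simp add: atLeast0LessThan)
    finally show ?thesis .
  qed
  have "d h j = d (lev k) j" if "j < k" for j
  proof -
    have "F (es ! j) \<le> lev k" using F_nth_mono[of j "k - 1"] that assms(1) by (simp add: lev_def)
    then show ?thesis
      using F_le_iff[OF nth_in_E, of j h] F_le_iff[OF nth_in_E, of j "lev k"] that assms(1,2)
      by (simp add: d_def)
  qed
  moreover have "d h j = d (lev k) j + (h - lev k) * (K (es ! j) / c (es ! j))"
    if "k \<le> j" "j < length es" for j
  proof -
    have "h \<le> F (es ! j)" using F_nth_mono[OF that] assms(3) by (simp add: lev_def)
    then show ?thesis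
      using le_F_iff[OF nth_in_E, of j h] le_F_iff[OF nth_in_E, of j "lev k"] that assms(2)
      by (simp add: d_def algebra_simps diff_divide_distrib)
  qed
  ultimately show ?thesis
    unfolding split by (simp add: slope_def sum.distrib sum_distrib_left)
qed

text \<open>
  If \<open>lev k = lev (Suc k)\<close>, then \<open>slope k\<close> also counts edges that are raised to \<open>u\<close>; this does
  no harm because the remainder \<open>\<Delta> - gain (lev k)\<close> vanishes.
\<close>

lemma interpolate:
  assumes k: "k < length es" and \<Delta>: "gain (lev k) \<le> \<Delta>" "\<Delta> \<le> gain (lev (Suc k))"
  defines "h \<equiv> lev k + (\<Delta> - gain (lev k)) / slope k"
  shows "gain h = \<Delta>" "0 \<le> h" "h \<le> F (es ! k)"
    and "e \<in> E \<Longrightarrow> (if F e \<le> lev k then u e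
      else w e + lev k / c e + (\<Delta> - gain (lev k)) / (c e * slope k)) = raise h e"
proof -
  have le: "lev k \<le> h" using \<Delta>(1) slope_pos[OF k] by (simp add: h_def)
  have rest: "\<Delta> - gain (lev k) = (h - lev k) * slope k"
    using slope_pos[OF k] by (simp add: h_def)
  have "\<Delta> - gain (lev k) \<le> (lev (Suc k) - lev k) * slope k"
    using gain_linear[OF k lev_mono[of k "Suc k"] order_refl] \<Delta>(2) k by simp
  then have h: "h \<le> lev (Suc k)" using slope_pos[OF k] unfolding rest by simp
  then show "h \<le> F (es ! k)" by (simp add: lev_def)
  show "gain h = \<Delta>" using gain_linear[OF k le h] rest by simp
  show "0 \<le> h" using lev_mono[of 0 k] k le by (simp add: lev_def)
  show "(if F e \<le> lev k then u e
      else w e + lev k / c e + (\<Delta> - gain (lev k)) / (c e * slope k)) = raise h e" if e: "e \<in> E"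
  proof (cases "F e \<le> lev k")
    case True
    then show ?thesis using F_le_iff[OF e, of h] le by (simp add: raise_def)
  next
    case False
    obtain j where j: "j < length es" "e = es ! j"
      using e set_es by (metis in_set_conv_nth)
    \<comment> \<open>By sortedness, an edge with \<open>F e\<close> above \<open>lev k\<close>
      stands after the first \<open>k\<close>; then \<open>h \<le> lev (Suc k) \<le> F e\<close>
      leaves it uncapped.\<close>
    have "k \<le> j"
    proof (rule ccontr)
      assume "\<not> k \<le> j"
      then have "j \<le> k - 1" "0 < k" "k - 1 < length es" using k by auto
      with False F_nth_mono[of j "k - 1"] k j(2) show False by (simp add: lev_def)
    qed
    then have "h \<le> F e" using h F_nth_mono[of k j] j by (simp add: lev_def)
    then have "raise h e = w e + h / c e" using le_F_iff[OF e] by (simp add: raise_def)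
    also have "h / c e = lev k / c e + (\<Delta> - gain (lev k)) / (c e * slope k)"
      unfolding rest using slope_pos[OF k] by (simp add: diff_divide_distrib)
    finally show ?thesis using False by simp
  qed
qed

end

section \<open>The algorithm on an instance\<close>

locale mcsdipt = tree_list es for es :: "(nat \<times> nat) list" +
  fixes w u c :: "nat \<times> nat \<Rightarrow> real"
  assumes nonempty: "es \<noteq> []"
    and w_le_u: "e \<in> set es \<Longrightarrow> w e \<le> u e"
    and c_pos: "e \<in> set es \<Longrightarrow> 0 < c e"
begin

sublocale capped "set es" "\<lambda>e. real (below e)" w u c
  using below_pos w_le_u c_pos by unfold_locales (simp_all, metis in_set_conv_nth)

lemma gain_eq: "capped_gain es w u c h = gain h"
  by (simp add: capped_gain_def gain_def)

lemma srd_sum: "srd (tree_of es) 0 x = (\<Sum>e\<in>set es. real (below e) * x e)"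
  by (simp add: srd_eq)

lemma srd_conv_nth: "srd (tree_of es) 0 x = (\<Sum>i<n. real (below (es ! i)) * x (es ! i))"
  by (simp add: srd_sum sum_set_conv_nth distinct)

lemma max_cost_le_iff:
  "max_cost (tree_of es) w c x \<le> h \<longleftrightarrow> (\<forall>e\<in>set es. c e * (x e - w e) \<le> h)"
  using nonempty by (simp add: max_cost_def)

text \<open>The lower bound behind both optimality and the failure of the start at \<open>1\<close>:
  a feasible solution forces its cost level to gain the missing amount.\<close>

lemma feasible_gain:
  assumes "feasible (tree_of es) 0 w u D y" "max_cost (tree_of es) w c y \<le> h"
  shows "D - srd (tree_of es) 0 w \<le> gain h"
  using gain_le_of_cost_le[of y h] assms by (simp add: feasible_def max_cost_le_iff srd_sum)

text \<open>The edge \<open>e\<close> attains cost exactly \<open>h\<close> and makes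
  \<open>gain\<close> strictly smaller below \<open>h\<close>, so no cheaper solution reaches
  \<open>D\<close>.\<close>

lemma raise_optimal:
  assumes h: "0 \<le> h" "e \<in> set es" "h \<le> F e" and gain: "gain h = D - srd (tree_of es) 0 w"
  shows "optimal (tree_of es) 0 w u c D (raise h)" "max_cost (tree_of es) w c (raise h) = h"
proof -
  show cost: "max_cost (tree_of es) w c (raise h) = h"
  proof (rule antisym)
    show "max_cost (tree_of es) w c (raise h) \<le> h"
      by (simp add: max_cost_le_iff cost_raise)
    have "h = c e * (raise h e - w e)" using cost_raise h by simp
    also have "\<dots> \<le> max_cost (tree_of es) w c (raise h)"
      using h(2) max_cost_le_iff by blast
    finally show "h \<le> max_cost (tree_of es) w c (raise h)" .
  qed
  have "w e \<le> raise h e \<and> raise h e \<le> u e" if "e \<in> set es" for e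
    using w_le_u[OF that] c_pos[OF that] h(1) by (simp add: raise_def)
  then have "feasible (tree_of es) 0 w u D (raise h)"
    using sum_raise[of h] gain by (simp add: feasible_def srd_sum)
  moreover have "h \<le> max_cost (tree_of es) w c y" if "feasible (tree_of es) 0 w u D y" for y
    using feasible_gain[OF that order_refl] gain_strict_mono[OF _ h(2,3)] gain
    by (metis not_le)
  ultimately show "optimal (tree_of es) 0 w u c D (raise h)"
    unfolding optimal_def cost by blast
qed

definition order :: "nat list" where
  "order = val (sort_by (map F es) [0..<n])"

definition sorted_edges :: "(nat \<times> nat) list" where
  "sorted_edges = map ((!) es) order"

lemma mset_order: "mset order = mset [0..<n]"
  by (simp add: order_def mset_sort_by)

lemma set_order: "set order = {..<n}"
  using mset_order by (metis atLeast_upt set_mset_mset)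

lemma length_order [simp]: "length order = n"
  using mset_order by (metis length_upt minus_nat.diff_0 size_mset)

lemma nth_order_less: "k < n \<Longrightarrow> order ! k < n"
  using set_order nth_mem[of k order] by auto

lemma mset_sorted_edges: "mset sorted_edges = mset es"
  by (simp only: sorted_edges_def mset_map mset_order) (simp only: mset_map [symmetric] map_nth)

sublocale srt: capped_sorted "set es" "\<lambda>e. real (below e)" w u c sorted_edges
proof
  show "distinct sorted_edges" "set sorted_edges = set es"
    using mset_sorted_edges distinct by (metis mset_eq_imp_distinct_iff, metis mset_eq_setD)
  have "map F sorted_edges = map ((!) (map F es)) order"
    using set_order by (simp add: sorted_edges_def)
  then show "sorted (map F sorted_edges)" by (simp add: order_def sorted_sort_by)
qed

lemma length_sorted_edges [simp]: "length sorted_edges = n"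
  by (simp add: sorted_edges_def)

lemma nth_sorted_edges: "k < n \<Longrightarrow> sorted_edges ! k = es ! (order ! k)"
  by (simp add: sorted_edges_def)

text \<open>The sorted list of values is determined by its multiset, however ties between edges are
  broken.\<close>

lemma sort_F: "sort (map (\<lambda>e. c e * (u e - w e)) es) = map F sorted_edges"
proof (rule properties_for_sort)
  show "mset (map F sorted_edges) = mset (map (\<lambda>e. c e * (u e - w e)) es)"
    by (simp add: mset_sorted_edges F_def [abs_def])
qed (rule srt.sorted)

abbreviation "L \<equiv> map (\<lambda>e. real (below e)) es"
abbreviation "f \<equiv> eval_f L (map w es) (map u es) (map c es) (map F es) order"

lemma val_level:
  assumes "k \<le> n"
  shows "val (level (map F es) order k) = srt.lev k"
  using assms nth_order_less[of "k - 1"]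
  by (simp add: level_def srt.lev_def nth_sorted_edges)

lemma val_f:
  assumes "k \<le> n"
  shows "val (f k) = gain (srt.lev k)"
  by (simp add: eval_f_def val_level assms gain_def sum_set_conv_nth distinct)

lemma slope_conv:
  assumes "k \<le> n"
  shows "srt.slope k = (\<Sum>i<n - k. L ! (order ! (k + i)) / map c es ! (order ! (k + i)))"
proof -
  have "srt.slope k = (\<Sum>i<n - k. real (below (sorted_edges ! (i + k))) / c (sorted_edges ! (i + k)))"
    using sum.shift_bounds_nat_ivl[of _ 0 k "n - k"] assms
    by (simp add: srt.slope_def atLeast0LessThan)
  then show ?thesis
    using nth_order_less by (simp add: nth_sorted_edges add.commute)
qed

lemma gain_lev_length: "gain (srt.lev n) = srd (tree_of es) 0 u - srd (tree_of es) 0 w"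
proof -
  have "F e \<le> srt.lev n" if "e \<in> set es" for e
  proof -
    have "e \<in> set sorted_edges" using that by (simp add: srt.set_es)
    then obtain j where "j < n" "e = sorted_edges ! j" by (auto simp: in_set_conv_nth)
    then show ?thesis using srt.F_nth_mono[of j "n - 1"] nonempty by (simp add: srt.lev_def)
  qed
  then show ?thesis by (simp add: gain_top srd_sum)
qed

text \<open>The array program in terms of edge functions; the start \<open>a0\<close> survives only
  in the index \<open>k\<close>.\<close>

lemma val_algorithm_A:
  fixes a0 D
  defines "\<Delta> \<equiv> D - srd (tree_of es) 0 w"
  defines "k \<equiv> val (search f \<Delta> a0 n 0)"
  shows "val (algorithm_A a0 es (map w es) (map u es) (map c es) D) =
    (if srd (tree_of es) 0 u < D then ([], \<infinity>)
     else if D < srd (tree_of es) 0 w then (map w es, 0)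
     else (map (\<lambda>e. if F e \<le> srt.lev k then u e
                    else w e + srt.lev k / c e + (\<Delta> - gain (srt.lev k)) / (c e * srt.slope k)) es,
           ereal (srt.lev k + (\<Delta> - gain (srt.lev k)) / srt.slope k)))"
proof -
  have k: "k \<le> n" unfolding k_def by (rule search_le)
  have tab: "map g [0..<n] = map g' es" if "\<And>i. i < n \<Longrightarrow> g i = g' (es ! i)" for g and g' :: "_ \<Rightarrow> real"
    using that by (intro nth_equalityI) simp_all
  have F: "map (\<lambda>i. map c es ! i * (map u es ! i - map w es ! i)) [0..<n] = map F es"
    by (rule tab) (simp add: F_def)
  have srd: "(\<Sum>i<n. L ! i * map x es ! i) = srd (tree_of es) 0 x" for x
    by (simp add: srd_conv_nth)
  show ?thesis
    unfolding algorithm_A_def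
    by (simp only: val_bind val_time_ops val_time_rd length_map val_leaf_counts val_tabulate val_total
        F srd \<Delta>_def [symmetric] order_def [symmetric] k_def [symmetric] val_level[OF k] val_f[OF k]
        slope_conv[OF k, symmetric] if_distrib[of val])
      (intro if_cong refl arg_cong2[where f = Pair] tab; simp)
qed

lemma solves_infeasible:
  assumes "srd (tree_of es) 0 u < D"
  shows "solves es w u c D ([], \<infinity>)"
proof -
  have "srd (tree_of es) 0 y \<le> srd (tree_of es) 0 u" if "feasible (tree_of es) 0 w u D y" for y
    using that unfolding srd_sum feasible_def by (intro sum_mono mult_left_mono) auto
  with assms show ?thesis unfolding solves_def feasible_def by fastforce
qed

lemma solves_trivial:
  assumes "D < srd (tree_of es) 0 w"
  shows "solves es w u c D (map w es, 0)"
proof -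
  obtain e where e: "e \<in> set es" using nonempty by (cases es) auto
  have cost: "max_cost (tree_of es) w c w = 0"
    using nonempty by (simp add: max_cost_def image_constant_conv)
  have "0 \<le> max_cost (tree_of es) w c y" if "feasible (tree_of es) 0 w u D y" for y
  proof -
    have "0 \<le> c e * (y e - w e)" using that e c_pos[OF e] by (simp add: feasible_def)
    also have "\<dots> \<le> max_cost (tree_of es) w c y" using max_cost_le_iff e by blast
    finally show ?thesis .
  qed
  moreover have feas: "feasible (tree_of es) 0 w u D w"
    using assms w_le_u by (simp add: feasible_def)
  ultimately have "optimal (tree_of es) 0 w u c D w"
    by (simp add: optimal_def cost)
  with feas cost show ?thesis by (auto simp: solves_def zero_ereal_def)
qed

lemma solves_interpolate:
  fixes D
  defines "\<Delta> \<equiv> D - srd (tree_of es) 0 w"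
  assumes k: "k < n" "gain (srt.lev k) \<le> \<Delta>" "\<Delta> \<le> gain (srt.lev (Suc k))"
  shows "solves es w u c D
    (map (\<lambda>e. if F e \<le> srt.lev k then u e
              else w e + srt.lev k / c e + (\<Delta> - gain (srt.lev k)) / (c e * srt.slope k)) es,
     ereal (srt.lev k + (\<Delta> - gain (srt.lev k)) / srt.slope k))"
proof -
  define h where "h = srt.lev k + (\<Delta> - gain (srt.lev k)) / srt.slope k"
  have k': "k < length sorted_edges" using k(1) by simp
  note * = srt.interpolate[OF k' k(2,3), folded h_def]
  \<comment> \<open>The edge at position \<open>k\<close> serves as the uncapped witness, since
    \<open>h \<le> lev (Suc k)\<close>.\<close>
  have "optimal (tree_of es) 0 w u c D (raise h)" "max_cost (tree_of es) w c (raise h) = h"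
    using raise_optimal[OF *(2) srt.nth_in_E[OF k'] *(3)] *(1) by (simp_all add: \<Delta>_def)
  moreover have "map (\<lambda>e. if F e \<le> srt.lev k then u e
      else w e + srt.lev k / c e + (\<Delta> - gain (srt.lev k)) / (c e * srt.slope k)) es = map (raise h) es"
    using *(4) by (intro map_cong refl)
  ultimately show ?thesis
    unfolding solves_def h_def [symmetric] by (auto simp: optimal_def)
qed

text \<open>If the search returns \<open>0\<close>, then \<open>n = 1\<close> or
  \<open>\<Delta> < f(1)\<close>; in both cases \<open>f(0) = 0 \<le> \<Delta> \<le> f(1)\<close>,
  so \<open>0\<close> is a correct index too.\<close>

lemma search_start_0:
  assumes "0 \<le> \<Delta>" "\<Delta> \<le> gain (srt.lev n)"
  defines "k \<equiv> val (search f \<Delta> 0 n 0)"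
  shows "k < n" "gain (srt.lev k) \<le> \<Delta>" "\<Delta> \<le> gain (srt.lev (Suc k))"
proof -
  have n: "0 < n" using nonempty by simp
  have "\<Delta> \<le> val (f n)" using assms by (simp add: val_f)
  from search_result[where f = f and n = n, OF this n, folded k_def]
  have "k < n \<and> gain (srt.lev k) \<le> \<Delta> \<and> \<Delta> \<le> gain (srt.lev (Suc k))"
    using assms(1,2) n by (auto simp: val_f srt.lev_def)
  then show "k < n" "gain (srt.lev k) \<le> \<Delta>" "\<Delta> \<le> gain (srt.lev (Suc k))" by auto
qed

text \<open>The index \<open>1\<close> is never tested, so the result is a genuine hit above
  \<open>1\<close> or \<open>0\<close>, and \<open>0\<close> is correct exactly if
  \<open>\<Delta> \<le> f(1)\<close>.\<close>

lemma search_start_1: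
  assumes "0 \<le> \<Delta>" "\<Delta> \<le> gain (srt.lev n)"
  defines "k \<equiv> val (search f \<Delta> 1 n 0)"
  shows "k < n"
    and "gain (srt.lev 1) < \<Delta> \<Longrightarrow> \<Delta> < gain (srt.lev 2) \<or> n = 2 \<Longrightarrow> k = 0"
    and "\<Delta> \<le> gain (srt.lev 1) \<or> n \<noteq> 2 \<and> gain (srt.lev 2) \<le> \<Delta> \<Longrightarrow>
      gain (srt.lev k) \<le> \<Delta> \<and> \<Delta> \<le> gain (srt.lev (Suc k))"
proof -
  have lev0: "gain (srt.lev 0) = 0" by (simp add: srt.lev_def)
  have res: "k < n \<and> (1 < k \<and> gain (srt.lev k) \<le> \<Delta> \<and> \<Delta> \<le> gain (srt.lev (Suc k)) \<or>
      k = 0 \<and> (n = 1 \<or> n = 2 \<or> \<Delta> < gain (srt.lev 2)))"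
  proof (cases "n = 1")
    case True
    then show ?thesis by (simp add: k_def search_stop)
  next
    case False
    with nonempty have n: "1 < n" by (cases es) auto
    have "\<Delta> \<le> val (f n)" using assms by (simp add: val_f)
    from search_result[where f = f and n = n, OF this n, folded k_def] n show ?thesis
      by (auto simp: val_f numeral_2_eq_2)
  qed
  then show "k < n" by simp
  \<comment> \<open>A hit above \<open>1\<close> would give
    \<open>f(2) \<le> f(k) \<le> \<Delta>\<close>; for \<open>n = 2\<close> it is excluded by
    \<open>k < n\<close>.\<close>
  have "gain (srt.lev 2) \<le> gain (srt.lev k)" if "1 < k"
    using that res by (intro gain_mono srt.lev_mono) auto
  with res show "k = 0" if "gain (srt.lev 1) < \<Delta>" "\<Delta> < gain (srt.lev 2) \<or> n = 2"
    using that by auto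
  show "gain (srt.lev k) \<le> \<Delta> \<and> \<Delta> \<le> gain (srt.lev (Suc k))"
    if "\<Delta> \<le> gain (srt.lev 1) \<or> n \<noteq> 2 \<and> gain (srt.lev 2) \<le> \<Delta>"
    using res that assms(1,2) lev0 by auto
qed

lemma needs_index_1_iff:
  "needs_index_1 es w u c D \<longleftrightarrow> 2 \<le> n \<and> D \<le> srd (tree_of es) 0 u \<and>
     gain (srt.lev 1) < D - srd (tree_of es) 0 w \<and>
     (D - srd (tree_of es) 0 w < gain (srt.lev 2) \<or> n = 2)"
proof -
  have "map F sorted_edges ! 0 = srt.lev 1" using nonempty by (simp add: srt.lev_def)
  moreover have "map F sorted_edges ! 1 = srt.lev 2" if "2 \<le> n"
    using that by (simp add: srt.lev_def)
  ultimately show ?thesis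
    unfolding needs_index_1_def Let_def sort_F gain_eq by auto
qed

text \<open>Both early exits precede the search, so \<open>a0\<close> is arbitrary.\<close>

lemma solves_outside:
  assumes "srd (tree_of es) 0 u < D \<or> D < srd (tree_of es) 0 w"
  shows "solves es w u c D (val (algorithm_A a0 es (map w es) (map u es) (map c es) D))"
proof (cases "srd (tree_of es) 0 u < D")
  case True
  then show ?thesis unfolding val_algorithm_A by (simp add: solves_infeasible)
next
  case False
  with assms show ?thesis unfolding val_algorithm_A by (simp add: solves_trivial)
qed

lemma solves_start_0: "solves es w u c D (val (algorithm_A 0 es (map w es) (map u es) (map c es) D))"
proof -
  let ?\<Delta> = "D - srd (tree_of es) 0 w"
  show ?thesis
  proof (cases "srd (tree_of es) 0 u < D \<or> D < srd (tree_of es) 0 w")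
    case True
    then show ?thesis by (rule solves_outside)
  next
    case False
    then have "0 \<le> ?\<Delta>" "?\<Delta> \<le> gain (srt.lev n)" unfolding gain_lev_length by simp_all
    from search_start_0[OF this] False show ?thesis
      unfolding val_algorithm_A by (simp add: solves_interpolate)
  qed
qed

text \<open>
  If the index \<open>1\<close> is needed, the search stops with \<open>k\<^sup>* = 0\<close>, and the level \<open>h = \<Delta> / slope 0\<close>
  that the algorithm reports exceeds the smallest \<open>F(e)\<close>. Some edges are then capped below \<open>h\<close>, so
  no solution of cost \<open>h\<close> gains \<open>\<Delta>\<close>.
\<close>

lemma not_solves_start_1:
  assumes needs: "needs_index_1 es w u c D"
  shows "\<not> solves es w u c D (val (algorithm_A 1 es (map w es) (map u es) (map c es) D))"
proof
  define \<Delta> where "\<Delta> = D - srd (tree_of es) 0 w"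
  define h where "h = \<Delta> / srt.slope 0"
  have n: "2 \<le> n" and feas: "\<not> srd (tree_of es) 0 u < D" and lev1: "gain (srt.lev 1) < \<Delta>"
    and lev2: "\<Delta> < gain (srt.lev 2) \<or> n = 2"
    using needs by (auto simp: needs_index_1_iff \<Delta>_def)
  have lev0: "srt.lev 0 = 0" by (simp add: srt.lev_def)
  have k0: "0 < length sorted_edges" using nonempty by simp
  have "0 \<le> gain (srt.lev 1)" using gain_mono[OF srt.lev_mono[of 0 1]] n lev0 by simp
  with lev1 have \<Delta>: "0 < \<Delta>" by simp
  have "\<Delta> \<le> gain (srt.lev n)" unfolding gain_lev_length using feas by (simp add: \<Delta>_def)
  with \<Delta> have "val (search f \<Delta> 1 n 0) = 0" using search_start_1(2)[of \<Delta>] lev1 lev2 by simp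
  \<comment> \<open>Level and gain vanish at index \<open>0\<close>, so the interpolated cost is
    \<open>\<Delta> / slope 0\<close>; positivity of \<open>\<Delta>\<close> excludes the early
    exit.\<close>
  with \<Delta> feas have out: "snd (val (algorithm_A 1 es (map w es) (map u es) (map c es) D)) = ereal h"
    unfolding val_algorithm_A \<Delta>_def [symmetric] by (simp add: lev0 h_def \<Delta>_def)
  \<comment> \<open>Up to the smallest \<open>F(e)\<close> no edge is capped.\<close>
  have "gain (srt.lev 1) = srt.lev 1 * srt.slope 0"
    using srt.gain_linear[OF k0, of "srt.lev 1"] srt.lev_mono[of 0 1] n lev0 by simp
  with lev1 have "srt.lev 1 < h" using srt.slope_pos[OF k0] by (simp add: h_def pos_less_divide_eq)
  then have "F (sorted_edges ! 0) < h" by (simp add: srt.lev_def)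
  from gain_less_linear[OF srt.nth_in_E[OF k0] this]
  have "gain h < (\<Sum>e\<in>set es. real (below e) / c e) * h" .
  also have "(\<Sum>e\<in>set es. real (below e) / c e) = srt.slope 0"
    using sum_set_conv_nth[OF srt.distinct, of "\<lambda>e. real (below e) / c e"]
    by (simp add: srt.slope_def srt.set_es atLeast0LessThan)
  also have "srt.slope 0 * h = \<Delta>" using srt.slope_pos[OF k0] by (simp add: h_def)
  finally have less: "gain h < \<Delta>" .
  assume "solves es w u c D (val (algorithm_A 1 es (map w es) (map u es) (map c es) D))"
  with out obtain x where "optimal (tree_of es) 0 w u c D x" "max_cost (tree_of es) w c x = h"
    by (auto simp: solves_def split: if_splits)
  then have "\<Delta> \<le> gain h" using feasible_gain[of D x h] by (simp add: optimal_def \<Delta>_def)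
  with less show False by simp
qed

lemma solves_start_1:
  assumes needs: "\<not> needs_index_1 es w u c D"
  shows "solves es w u c D (val (algorithm_A 1 es (map w es) (map u es) (map c es) D))"
proof -
  let ?\<Delta> = "D - srd (tree_of es) 0 w"
  show ?thesis
  proof (cases "srd (tree_of es) 0 u < D \<or> D < srd (tree_of es) 0 w")
    case True
    then show ?thesis by (rule solves_outside)
  next
    case False
    then have \<Delta>: "0 \<le> ?\<Delta>" "?\<Delta> \<le> gain (srt.lev n)" unfolding gain_lev_length by simp_all
    \<comment> \<open>For \<open>n = 1\<close> the level \<open>1\<close> is already the top level,
      so feasibility gives the first alternative.\<close>
    have "?\<Delta> \<le> gain (srt.lev 1) \<or> n \<noteq> 2 \<and> gain (srt.lev 2) \<le> ?\<Delta>"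
    proof (cases "2 \<le> n")
      case True
      with needs False show ?thesis by (auto simp: needs_index_1_iff)
    next
      case False
      moreover have "0 < n" using nonempty by simp
      ultimately have "n = 1" by linarith
      with \<Delta>(2) show ?thesis by simp
    qed
    from search_start_1(1)[OF \<Delta>] search_start_1(3)[OF \<Delta> this] False show ?thesis
      unfolding val_algorithm_A by (simp add: solves_interpolate del: One_nat_def)
  qed
qed

end

lemma mcsdipt_if_instance: "mcsdipt_instance es w u c \<Longrightarrow> mcsdipt es w u c"
  by unfold_locales (auto simp: mcsdipt_instance_def)

theorem theorem6:
  shows "\<exists>t \<in> O(\<lambda>n. real n * ln (real n)). \<forall>es w u c D. mcsdipt_instance es w u c \<longrightarrow>
     solves es w u c D (val (algorithm_A 0 es (map w es) (map u es) (map c es) D)) \<and>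
     (solves es w u c D (val (algorithm_A 1 es (map w es) (map u es) (map c es) D))
        \<longleftrightarrow> \<not> needs_index_1 es w u c D) \<and>
     (\<forall>a0\<in>{0, 1}.
        real (time (algorithm_A a0 es (map w es) (map u es) (map c es) D)) \<le> t (length es))"
proof (rule bexI[OF _ bigo_log_bound], intro allI impI)
  fix es w u c D assume "mcsdipt_instance es w u c"
  then interpret mcsdipt es w u c by (rule mcsdipt_if_instance)
  show "solves es w u c D (val (algorithm_A 0 es (map w es) (map u es) (map c es) D)) \<and>
     (solves es w u c D (val (algorithm_A 1 es (map w es) (map u es) (map c es) D))
        \<longleftrightarrow> \<not> needs_index_1 es w u c D) \<and>
     (\<forall>a0\<in>{0, 1}.
        real (time (algorithm_A a0 es (map w es) (map u es) (map c es) D))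
          \<le> real (100 * (length es + 1) * (log_bound (length es) + 1)))"
  proof (intro conjI ballI)
    fix a0 :: nat
    show "real (time (algorithm_A a0 es (map w es) (map u es) (map c es) D))
        \<le> real (100 * (length es + 1) * (log_bound (length es) + 1))"
      by (intro of_nat_mono time_algorithm_A le_two_power_log_bound) simp_all
  qed (use solves_start_0 solves_start_1 not_solves_start_1 in blast)+
qed

end
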